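(* Let $A$ be a reduced Gelfand ring. Then the pure ideals of $A$ are precisely the ideals of the form $\bigcap_{\mathfrak{m}\in\operatorname{Max}(A)\cap E}\operatorname{Ker}\pi_{\mathfrak{m}}$, where $E$ is a Zariski closed subset of $\operatorname{Spec}(A)$.
   Context: All rings are commutative (with unit). A ring is a Gelfand ring if each of its prime ideals is contained in a unique maximal ideal. An ideal $I$ of $A$ is pure if the canonical ring map $A\to A/I$ is flat. For a prime ideal $\mathfrak{p}$, $\pi_{\mathfrak{p}}:A\to A_{\mathfrak{p}}$ is the canonical ring map. $\operatorname{Max}(A)$ is the set of maximal ideals. The empty intersection of ideals is $A$. *)

theory Defs
  imports "HOL-Algebra.QuotRing" "HOL-Algebra.Module" "HOL-Algebra.Free_Abelian_Groups"
begin

section \<open>Reduced rings, Gelfand rings and the spectrum\<close>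

definition reduced_ring :: "('a, 'm) ring_scheme \<Rightarrow> bool" where
  "reduced_ring A \<longleftrightarrow>
     (\<forall>a \<in> carrier A. \<forall>n::nat. a [^]\<^bsub>A\<^esub> n = \<zero>\<^bsub>A\<^esub> \<longrightarrow> a = \<zero>\<^bsub>A\<^esub>)"

definition Spec :: "('a, 'm) ring_scheme \<Rightarrow> 'a set set" where
  "Spec A = {P. primeideal P A}"

definition MaxSpec :: "('a, 'm) ring_scheme \<Rightarrow> 'a set set" where
  "MaxSpec A = {M. maximalideal M A}"

definition zariski_closed :: "('a, 'm) ring_scheme \<Rightarrow> 'a set set \<Rightarrow> bool" where
  "zariski_closed A E \<longleftrightarrow> (\<exists>S \<subseteq> carrier A. E = {P \<in> Spec A. S \<subseteq> P})"

definition gelfand_ring :: "('a, 'm) ring_scheme \<Rightarrow> bool" where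
  "gelfand_ring A \<longleftrightarrow> (\<forall>P \<in> Spec A. \<exists>!M. M \<in> MaxSpec A \<and> P \<subseteq> M)"


section \<open>Localization\<close>

text \<open>Fractions are classes of pairs (numerator, denominator). The operations on classes are unions
  over all representatives; for a multiplicative set all the classes united coincide.\<close>

definition loc_rel :: "('a, 'm) ring_scheme \<Rightarrow> 'a set \<Rightarrow> (('a \<times> 'a) \<times> ('a \<times> 'a)) set" where
  "loc_rel A S =
     {((a, s), (b, t)) | a s b t. a \<in> carrier A \<and> b \<in> carrier A \<and> s \<in> S \<and> t \<in> S \<and>
        (\<exists>u \<in> S. u \<otimes>\<^bsub>A\<^esub> (a \<otimes>\<^bsub>A\<^esub> t \<ominus>\<^bsub>A\<^esub> b \<otimes>\<^bsub>A\<^esub> s) = \<zero>\<^bsub>A\<^esub>)}"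

definition loc_frac :: "('a, 'm) ring_scheme \<Rightarrow> 'a set \<Rightarrow> 'a \<Rightarrow> 'a \<Rightarrow> ('a \<times> 'a) set" where
  "loc_frac A S a s = loc_rel A S `` {(a, s)}"

definition localization :: "('a, 'm) ring_scheme \<Rightarrow> 'a set \<Rightarrow> ('a \<times> 'a) set ring" where
  "localization A S =
     \<lparr>carrier = (carrier A \<times> S) // loc_rel A S,
      monoid.mult = (\<lambda>V W. \<Union>(a, s) \<in> V. \<Union>(b, t) \<in> W. loc_frac A S (a \<otimes>\<^bsub>A\<^esub> b) (s \<otimes>\<^bsub>A\<^esub> t)),
      one = loc_frac A S \<one>\<^bsub>A\<^esub> \<one>\<^bsub>A\<^esub>,
      ring.zero = loc_frac A S \<zero>\<^bsub>A\<^esub> \<one>\<^bsub>A\<^esub>,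
      ring.add = (\<lambda>V W. \<Union>(a, s) \<in> V. \<Union>(b, t) \<in> W.
               loc_frac A S (a \<otimes>\<^bsub>A\<^esub> t \<oplus>\<^bsub>A\<^esub> b \<otimes>\<^bsub>A\<^esub> s) (s \<otimes>\<^bsub>A\<^esub> t))\<rparr>"

definition localization_at :: "('a, 'm) ring_scheme \<Rightarrow> 'a set \<Rightarrow> ('a \<times> 'a) set ring" where
  "localization_at A P = localization A (carrier A - P)"

definition loc_map :: "('a, 'm) ring_scheme \<Rightarrow> 'a set \<Rightarrow> 'a \<Rightarrow> ('a \<times> 'a) set" where
  "loc_map A P a = loc_frac A (carrier A - P) a \<one>\<^bsub>A\<^esub>"


section \<open>Tensor products and flatness\<close>

definition module_homs ::
  "('a, 'r) ring_scheme \<Rightarrow> ('a, 'b, 'm) module_scheme \<Rightarrow> ('a, 'c, 'n) module_scheme \<Rightarrow> ('b \<Rightarrow> 'c) set"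
  where
  "module_homs R M N =
     {f \<in> carrier M \<rightarrow> carrier N.
        (\<forall>x \<in> carrier M. \<forall>y \<in> carrier M. f (x \<oplus>\<^bsub>M\<^esub> y) = f x \<oplus>\<^bsub>N\<^esub> f y) \<and>
        (\<forall>r \<in> carrier R. \<forall>x \<in> carrier M. f (r \<odot>\<^bsub>M\<^esub> x) = r \<odot>\<^bsub>N\<^esub> f x)}"

definition tensor_relators ::
  "('a, 'r) ring_scheme \<Rightarrow> ('a, 'b, 'm) module_scheme \<Rightarrow> ('a, 'c, 'n) module_scheme
     \<Rightarrow> ('b \<times> 'c \<Rightarrow>\<^sub>0 int) set" where
  "tensor_relators R M N =
     {frag_of (x \<oplus>\<^bsub>M\<^esub> y, z) - frag_of (x, z) - frag_of (y, z) | x y z.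
        x \<in> carrier M \<and> y \<in> carrier M \<and> z \<in> carrier N} \<union>
     {frag_of (x, y \<oplus>\<^bsub>N\<^esub> z) - frag_of (x, y) - frag_of (x, z) | x y z.
        x \<in> carrier M \<and> y \<in> carrier N \<and> z \<in> carrier N} \<union>
     {frag_of (r \<odot>\<^bsub>M\<^esub> x, y) - frag_of (x, r \<odot>\<^bsub>N\<^esub> y) | r x y.
        r \<in> carrier R \<and> x \<in> carrier M \<and> y \<in> carrier N}"

definition tensor_free ::
  "('a, 'b, 'm) module_scheme \<Rightarrow> ('a, 'c, 'n) module_scheme \<Rightarrow> ('b \<times> 'c \<Rightarrow>\<^sub>0 int) monoid" where
  "tensor_free M N = free_Abelian_group (carrier M \<times> carrier N)"

definition tensor_null ::
  "('a, 'r) ring_scheme \<Rightarrow> ('a, 'b, 'm) module_scheme \<Rightarrow> ('a, 'c, 'n) module_scheme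
     \<Rightarrow> ('b \<times> 'c \<Rightarrow>\<^sub>0 int) set" where
  "tensor_null R M N = generate (tensor_free M N) (tensor_relators R M N)"

text \<open>The underlying abelian group (written multiplicatively, as the free abelian groups of
  HOL-Algebra are) of the tensor product of M and N over R. Flatness only needs to know whether a map
  of tensor products is injective, so the R-action on the tensor product is not defined.\<close>

definition tensor_group ::
  "('a, 'r) ring_scheme \<Rightarrow> ('a, 'b, 'm) module_scheme \<Rightarrow> ('a, 'c, 'n) module_scheme
     \<Rightarrow> ('b \<times> 'c \<Rightarrow>\<^sub>0 int) set monoid" where
  "tensor_group R M N = tensor_free M N Mod tensor_null R M N"

text \<open>The map induced by f from the tensor product of M and N to that of M and N', given on cosets as a
  union over all representatives, which lie in a single coset when f is R-linear.\<close>

definition tensor_map ::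
  "('a, 'r) ring_scheme \<Rightarrow> ('a, 'b, 'm) module_scheme \<Rightarrow> ('a, 'd, 'k) module_scheme \<Rightarrow> ('c \<Rightarrow> 'd)
     \<Rightarrow> ('b \<times> 'c \<Rightarrow>\<^sub>0 int) set \<Rightarrow> ('b \<times> 'd \<Rightarrow>\<^sub>0 int) set" where
  "tensor_map R M N' f V =
     (\<Union>c \<in> V. tensor_null R M N' #>\<^bsub>tensor_free M N'\<^esub>
                frag_extend (\<lambda>(x, y). frag_of (x, f y)) c)"

text \<open>HOL cannot quantify over types inside a definition, so the test modules N and N' take their
  elements in the type 'a + 'u. Since 'u is arbitrary, this covers modules on every type 'u; since
  'a is a summand, all ideals of R are (up to isomorphism) among the test modules even for small 'u,
  and the notion does not degenerate.\<close>

definition flat_module ::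
  "'u itself \<Rightarrow> ('a, 'r) ring_scheme \<Rightarrow> ('a, 'b, 'm) module_scheme \<Rightarrow> bool" where
  "flat_module _ R M \<longleftrightarrow>
     module R M \<and>
     (\<forall>(N :: ('a, 'a + 'u) module) (N' :: ('a, 'a + 'u) module) f.
        module R N \<and> module R N' \<and> f \<in> module_homs R N N' \<and> inj_on f (carrier N) \<longrightarrow>
        inj_on (tensor_map R M N' f) (carrier (tensor_group R M N)))"

definition restrict_scalars ::
  "('b, 'm) ring_scheme \<Rightarrow> ('a \<Rightarrow> 'b) \<Rightarrow> ('a, 'b) module" where
  "restrict_scalars B \<phi> =
     \<lparr>carrier = carrier B, monoid.mult = monoid.mult B, one = one B, ring.zero = ring.zero B, ring.add = ring.add B,
      smult = (\<lambda>a b. \<phi> a \<otimes>\<^bsub>B\<^esub> b)\<rparr>"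

definition flat_ring_hom ::
  "'u itself \<Rightarrow> ('a, 'm) ring_scheme \<Rightarrow> ('b, 'n) ring_scheme \<Rightarrow> ('a \<Rightarrow> 'b) \<Rightarrow> bool" where
  "flat_ring_hom U A B \<phi> \<longleftrightarrow> \<phi> \<in> ring_hom A B \<and> flat_module U A (restrict_scalars B \<phi>)"

definition pure_ideal :: "'u itself \<Rightarrow> ('a, 'm) ring_scheme \<Rightarrow> 'a set \<Rightarrow> bool" where
  "pure_ideal U A I \<longleftrightarrow> ideal I A \<and> flat_ring_hom U A (A Quot I) (\<lambda>a. I +>\<^bsub>A\<^esub> a)"

end

theory Submission
  imports Defs
begin

text \<open>Write $\pi_M$ for the canonical map to the localization at $M$. An ideal $I$ is pure
  exactly when every $a \in I$ is fixed by some $e \in I$, that is $e a = a$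
  (\<open>pure_ideal_iff_local_units\<close>); the rest is ring theory.

  For purity, every element of $A/I \otimes N$ is a pure tensor $1 \otimes y$ with $y \in N$
  (\<open>ex_pure_tensor\<close>), and $1 \otimes y = 0$ forces $y$ into every subgroup of $N$ that contains all
  products $i x$ with $i \in I$ and $x \in N$ (\<open>null_imp_mem_subgroup\<close>). If $A/I$ is flat, tensor the
  inclusion of the principal ideal $aA$ into $A$, for $a \in I$: the tensor $1 \otimes a$ vanishes in
  $A/I \otimes A$, hence in $A/I \otimes aA$, and so $a \in I a$. Conversely, if elements of $I$ are
  fixed by elements of $I$, then $1 \otimes y = 0$ says just that $e y = y$ for some $e \in I$, and such an
  equation passes from $N'$ back to $N$ along an injective map.

  Now $\pi_M(a) = 0$ means that the annihilator of $a$ is not contained in $M$. For a pure ideal $I$,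
  the intersection of the kernels over the maximal $M \supseteq I$ is $I$ itself: if $a$ lies in all of
  them, then no maximal ideal contains both $I$ and the annihilator of $a$, so that $1 = x + i$ with
  $x a = 0$ and $i \in I$, whence $a = i a$ (\<open>eq_vanishing_near_self\<close>).

  For the converse inclusion the Gelfand condition enters through an elementwise form
  (\<open>gelfand_orthogonal\<close>): if $u + s = 1$, then $(1 - c u)(1 - d s) = 0$ for suitable $c$ and $d$. If
  $a$ lies in the intersection of the kernels over the maximal $M \supseteq S$, then $1 = u + s$ with
  $u a = 0$ and $s$ in the ideal generated by $S$. The element $e = 1 - c u$ fixes $a$, and it lies in the
  same intersection, because it is killed by $1 - d s$, which is outside every maximal
  $M \supseteq S$ (\<open>vanishing_near_local_units\<close>).\<close>

section \<open>The kernel of a map of tensor products\<close>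

lemma carrier_tensor_free [simp]:
  "c \<in> carrier (tensor_free M N) \<longleftrightarrow> Poly_Mapping.keys c \<subseteq> carrier M \<times> carrier N"
  by (simp add: tensor_free_def)

lemma tensor_free_group [simp]:
  "group (tensor_free M N)" "c \<otimes>\<^bsub>tensor_free M N\<^esub> d = c + d" "\<one>\<^bsub>tensor_free M N\<^esub> = 0"
  by (simp_all add: tensor_free_def)

lemma inv_tensor_free:
  "c \<in> carrier (tensor_free M N) \<Longrightarrow> inv\<^bsub>tensor_free M N\<^esub> c = - c"
  by (simp add: tensor_free_def)

lemma keys_diff_subset:
  "Poly_Mapping.keys c \<subseteq> S \<Longrightarrow> Poly_Mapping.keys d \<subseteq> S \<Longrightarrow> Poly_Mapping.keys (c - d) \<subseteq> S"
  for c d :: "'a \<Rightarrow>\<^sub>0 int"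
  using keys_diff[of c d] by blast

text \<open>The proofs below never inspect a generated element: they show that a subgroup contains
  the tensor product relations and hence all of \<^const>\<open>tensor_null\<close>.\<close>

lemma tensor_relators_subsetI:
  assumes "\<And>x y z. x \<in> carrier M \<Longrightarrow> y \<in> carrier M \<Longrightarrow> z \<in> carrier N \<Longrightarrow>
      frag_of (x \<oplus>\<^bsub>M\<^esub> y, z) - frag_of (x, z) - frag_of (y, z) \<in> T"
    and "\<And>x y z. x \<in> carrier M \<Longrightarrow> y \<in> carrier N \<Longrightarrow> z \<in> carrier N \<Longrightarrow>
      frag_of (x, y \<oplus>\<^bsub>N\<^esub> z) - frag_of (x, y) - frag_of (x, z) \<in> T"
    and "\<And>r x y. r \<in> carrier R \<Longrightarrow> x \<in> carrier M \<Longrightarrow> y \<in> carrier N \<Longrightarrow>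
      frag_of (r \<odot>\<^bsub>M\<^esub> x, y) - frag_of (x, r \<odot>\<^bsub>N\<^esub> y) \<in> T"
  shows "tensor_relators R M N \<subseteq> T"
  unfolding tensor_relators_def using assms by blast

context
  fixes R :: "('a, 'r) ring_scheme" and M :: "('a, 'b, 'm) module_scheme"
    and N :: "('a, 'c, 'n) module_scheme"
  assumes mods: "module R M" "module R N"
begin

interpretation M: module R M by (rule mods)
interpretation N: module R N by (rule mods)

lemma tensor_relators_in_carrier: "tensor_relators R M N \<subseteq> carrier (tensor_free M N)"
  by (rule tensor_relators_subsetI) (simp_all add: keys_diff_subset)

lemma subgroup_tensor_null: "subgroup (tensor_null R M N) (tensor_free M N)"
  unfolding tensor_null_def
  by (rule group.generate_is_subgroup) (use tensor_relators_in_carrier in simp_all)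

lemma tensor_null_in_carrier:
  "c \<in> tensor_null R M N \<Longrightarrow> Poly_Mapping.keys c \<subseteq> carrier M \<times> carrier N"
  using subgroup.mem_carrier[OF subgroup_tensor_null, of c] by simp

lemma tensor_null_zero: "0 \<in> tensor_null R M N"
  using subgroup.one_closed[OF subgroup_tensor_null] by simp

lemma tensor_null_add:
  "c \<in> tensor_null R M N \<Longrightarrow> d \<in> tensor_null R M N \<Longrightarrow> c + d \<in> tensor_null R M N"
  using subgroup.m_closed[OF subgroup_tensor_null, of c d] by simp

lemma tensor_null_uminus: "c \<in> tensor_null R M N \<Longrightarrow> - c \<in> tensor_null R M N"
  using subgroup.m_inv_closed[OF subgroup_tensor_null, of c]
  by (simp add: inv_tensor_free tensor_null_in_carrier)

lemma tensor_null_diff: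
  "c \<in> tensor_null R M N \<Longrightarrow> d \<in> tensor_null R M N \<Longrightarrow> c - d \<in> tensor_null R M N"
  using tensor_null_add[of c "- d"] tensor_null_uminus by simp

lemma tensor_null_diff_left:
  "c - d \<in> tensor_null R M N \<Longrightarrow> c \<in> tensor_null R M N \<longleftrightarrow> d \<in> tensor_null R M N"
  using tensor_null_add[of "c - d" d] tensor_null_diff[of c "c - d"] by auto

lemma tensor_null_smult_swap:
  assumes "r \<in> carrier R" "x \<in> carrier M" "y \<in> carrier N"
  shows "frag_of (r \<odot>\<^bsub>M\<^esub> x, y) - frag_of (x, r \<odot>\<^bsub>N\<^esub> y) \<in> tensor_null R M N"
  unfolding tensor_null_def
  by (rule generate.incl) (use assms in \<open>auto simp: tensor_relators_def\<close>)

lemma tensor_null_add_right: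
  assumes "x \<in> carrier M" "y \<in> carrier N" "z \<in> carrier N"
  shows "frag_of (x, y \<oplus>\<^bsub>N\<^esub> z) - frag_of (x, y) - frag_of (x, z) \<in> tensor_null R M N"
  unfolding tensor_null_def
  by (rule generate.incl) (use assms in \<open>auto simp: tensor_relators_def\<close>)

lemma tensor_null_add_left:
  assumes "x \<in> carrier M" "y \<in> carrier M" "z \<in> carrier N"
  shows "frag_of (x \<oplus>\<^bsub>M\<^esub> y, z) - frag_of (x, z) - frag_of (y, z) \<in> tensor_null R M N"
  unfolding tensor_null_def
  by (rule generate.incl) (use assms in \<open>auto simp: tensor_relators_def\<close>)

lemma tensor_null_zero_left:
  assumes "z \<in> carrier N"
  shows "frag_of (\<zero>\<^bsub>M\<^esub>, z) \<in> tensor_null R M N"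
  using tensor_null_uminus[OF tensor_null_add_left[of "\<zero>\<^bsub>M\<^esub>" "\<zero>\<^bsub>M\<^esub>" z]] assms by simp

lemma tensor_null_zero_right:
  assumes "x \<in> carrier M"
  shows "frag_of (x, \<zero>\<^bsub>N\<^esub>) \<in> tensor_null R M N"
  using tensor_null_uminus[OF tensor_null_add_right[of x "\<zero>\<^bsub>N\<^esub>" "\<zero>\<^bsub>N\<^esub>"]] assms by simp

lemma tensor_null_diff_right:
  assumes "x \<in> carrier M" "y \<in> carrier N" "z \<in> carrier N"
  shows "frag_of (x, y) - frag_of (x, z) - frag_of (x, y \<ominus>\<^bsub>N\<^esub> z) \<in> tensor_null R M N"
proof -
  have "(y \<ominus>\<^bsub>N\<^esub> z) \<oplus>\<^bsub>N\<^esub> z = y"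
    using assms by (simp add: a_minus_def N.a_assoc N.l_neg)
  then show ?thesis
    using tensor_null_add_right[of x "y \<ominus>\<^bsub>N\<^esub> z" z] assms by (simp add: algebra_simps)
qed

lemma tensor_coset_eq_iff:
  assumes "c \<in> carrier (tensor_free M N)" "d \<in> carrier (tensor_free M N)"
  shows "tensor_null R M N #>\<^bsub>tensor_free M N\<^esub> c = tensor_null R M N #>\<^bsub>tensor_free M N\<^esub> d
     \<longleftrightarrow> c - d \<in> tensor_null R M N"
proof -
  let ?K = "tensor_null R M N" and ?F = "tensor_free M N"
  have mem: "x \<in> ?K #>\<^bsub>?F\<^esub> y \<longleftrightarrow> x - y \<in> ?K" for x y
    by (auto simp: r_coset_def intro!: bexI[of _ "x - y"])
  show ?thesis
  proof
    assume "?K #>\<^bsub>?F\<^esub> c = ?K #>\<^bsub>?F\<^esub> d"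
    then show "c - d \<in> ?K"
      using mem[of c c] mem[of c d] tensor_null_zero by simp
  next
    assume "c - d \<in> ?K"
    then show "?K #>\<^bsub>?F\<^esub> c = ?K #>\<^bsub>?F\<^esub> d"
      using tensor_null_add[of _ "c - d"] tensor_null_diff[of _ "c - d"]
      by (fastforce simp: mem set_eq_iff)
  qed
qed

lemma carrier_tensor_group:
  "carrier (tensor_group R M N) =
     (\<lambda>c. tensor_null R M N #>\<^bsub>tensor_free M N\<^esub> c) ` carrier (tensor_free M N)"
  by (auto simp: tensor_group_def carrier_FactGroup)

end

abbreviation frag_map_right :: "('c \<Rightarrow> 'd) \<Rightarrow> ('b \<times> 'c \<Rightarrow>\<^sub>0 int) \<Rightarrow> ('b \<times> 'd \<Rightarrow>\<^sub>0 int)" where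
  "frag_map_right f \<equiv> frag_extend (\<lambda>(x, y). frag_of (x, f y))"

context
  fixes R :: "('a, 'r) ring_scheme" and M :: "('a, 'b, 'm) module_scheme"
    and N :: "('a, 'c, 'n) module_scheme" and N' :: "('a, 'd, 'k) module_scheme" and f :: "'c \<Rightarrow> 'd"
  assumes mods: "module R M" "module R N" "module R N'" and f: "f \<in> module_homs R N N'"
begin

interpretation M: module R M by (rule mods)
interpretation N: module R N by (rule mods)
interpretation N': module R N' by (rule mods)

lemma frag_map_right_in_carrier:
  assumes "c \<in> carrier (tensor_free M N)"
  shows "frag_map_right f c \<in> carrier (tensor_free M N')"
proof -
  have "Poly_Mapping.keys (frag_map_right f c) \<subseteq> (\<lambda>(x, y). (x, f y)) ` Poly_Mapping.keys c"
    by (rule order_trans[OF keys_frag_extend]) auto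
  also have "\<dots> \<subseteq> carrier M \<times> carrier N'"
    using assms f by (fastforce simp: module_homs_def)
  finally show ?thesis
    by simp
qed

lemma frag_map_right_null:
  assumes "c \<in> tensor_null R M N"
  shows "frag_map_right f c \<in> tensor_null R M N'"
proof -
  let ?T = "{c \<in> carrier (tensor_free M N). frag_map_right f c \<in> tensor_null R M N'}"
  note [simp] = frag_extend_add frag_extend_diff frag_extend_minus
  have fN: "f y \<in> carrier N'" if "y \<in> carrier N" for y
    using f that by (auto simp: module_homs_def)
  have "subgroup ?T (tensor_free M N)"
  proof (rule group.subgroupI)
    show "?T \<noteq> {}"
      using tensor_null_zero[OF mods(1,3)] by (auto intro!: exI[of _ 0])
    show "inv\<^bsub>tensor_free M N\<^esub> c \<in> ?T" if "c \<in> ?T" for c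
      using that tensor_null_uminus[OF mods(1,3)] by (auto simp: inv_tensor_free)
    show "c \<otimes>\<^bsub>tensor_free M N\<^esub> d \<in> ?T" if "c \<in> ?T" "d \<in> ?T" for c d
      using that tensor_null_add[OF mods(1,3)] keys_add[of c d] by auto
  qed auto
  moreover have "tensor_relators R M N \<subseteq> ?T"
    using f fN
    by (intro tensor_relators_subsetI)
      (simp_all add: keys_diff_subset module_homs_def tensor_null_add_left[OF mods(1,3)]
        tensor_null_add_right[OF mods(1,3)] tensor_null_smult_swap[OF mods(1,3)])
  ultimately have "tensor_null R M N \<subseteq> ?T"
    unfolding tensor_null_def by (intro group.generate_subgroup_incl) auto
  with assms show ?thesis
    by blast
qed

text \<open>The union over all representatives in \<^const>\<open>tensor_map\<close> is a single coset because null
  elements are mapped to null elements.\<close>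

lemma tensor_map_coset:
  assumes "c \<in> carrier (tensor_free M N)"
  shows "tensor_map R M N' f (tensor_null R M N #>\<^bsub>tensor_free M N\<^esub> c) =
     tensor_null R M N' #>\<^bsub>tensor_free M N'\<^esub> frag_map_right f c"
proof -
  have "tensor_null R M N' #>\<^bsub>tensor_free M N'\<^esub> frag_map_right f (k + c) =
      tensor_null R M N' #>\<^bsub>tensor_free M N'\<^esub> frag_map_right f c" if k: "k \<in> tensor_null R M N" for k
  proof (subst tensor_coset_eq_iff[OF mods(1,3)])
    have "k + c \<in> carrier (tensor_free M N)"
      using assms tensor_null_in_carrier[OF mods(1,2) k] keys_add[of k c] by auto
    then show "frag_map_right f (k + c) \<in> carrier (tensor_free M N')"
      by (rule frag_map_right_in_carrier)
    show "frag_map_right f c \<in> carrier (tensor_free M N')"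
      using assms by (rule frag_map_right_in_carrier)
    show "frag_map_right f (k + c) - frag_map_right f c \<in> tensor_null R M N'"
      using frag_map_right_null[OF k] by (simp add: frag_extend_add)
  qed
  then show ?thesis
    using tensor_null_zero[OF mods(1,2)] unfolding tensor_map_def r_coset_def[of "tensor_free M N"]
    by fastforce
qed

text \<open>A homomorphism is injective if its kernel is trivial; on representatives, the tensor
  product can be forgotten and only the null elements of the free abelian groups remain.\<close>

lemma inj_on_tensor_map_iff:
  "inj_on (tensor_map R M N' f) (carrier (tensor_group R M N)) \<longleftrightarrow>
     (\<forall>c \<in> carrier (tensor_free M N).
        frag_map_right f c \<in> tensor_null R M N' \<longrightarrow> c \<in> tensor_null R M N)"
    (is "?inj \<longleftrightarrow> ?ker")
proof -
  let ?q = "\<lambda>c. tensor_null R M N #>\<^bsub>tensor_free M N\<^esub> c"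
  have eq: "tensor_map R M N' f (?q c) = tensor_map R M N' f (?q d) \<longleftrightarrow>
      frag_map_right f (c - d) \<in> tensor_null R M N'"
    if "c \<in> carrier (tensor_free M N)" "d \<in> carrier (tensor_free M N)" for c d
    using that
    by (simp add: tensor_map_coset tensor_coset_eq_iff[OF mods(1,3)] frag_extend_diff
        frag_map_right_in_carrier del: carrier_tensor_free)
  have "?inj \<longleftrightarrow> (\<forall>c \<in> carrier (tensor_free M N). \<forall>d \<in> carrier (tensor_free M N).
      frag_map_right f (c - d) \<in> tensor_null R M N' \<longrightarrow> c - d \<in> tensor_null R M N)"
    unfolding inj_on_def carrier_tensor_group[OF mods(1,2)]
    by (simp add: eq tensor_coset_eq_iff[OF mods(1,2)] del: carrier_tensor_free)
  also have "\<dots> \<longleftrightarrow> ?ker"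
  proof
    assume *: "\<forall>c \<in> carrier (tensor_free M N). \<forall>d \<in> carrier (tensor_free M N).
      frag_map_right f (c - d) \<in> tensor_null R M N' \<longrightarrow> c - d \<in> tensor_null R M N"
    show ?ker
      using * by (metis carrier_tensor_free diff_zero empty_subsetI keys_zero)
  next
    assume ?ker
    then show "\<forall>c \<in> carrier (tensor_free M N). \<forall>d \<in> carrier (tensor_free M N).
      frag_map_right f (c - d) \<in> tensor_null R M N' \<longrightarrow> c - d \<in> tensor_null R M N"
      by (simp add: keys_diff_subset)
  qed
  finally show ?thesis .
qed

end

section \<open>Tensoring with a quotient of the ring\<close>

abbreviation quot_module :: "('a, 'm) ring_scheme \<Rightarrow> 'a set \<Rightarrow> ('a, 'a set) module" where
  "quot_module A I \<equiv> restrict_scalars (A Quot I) (\<lambda>a. I +>\<^bsub>A\<^esub> a)"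

lemma restrict_scalars_module:
  assumes "cring A" "cring B" "\<phi> \<in> ring_hom A B"
  shows "module A (restrict_scalars B \<phi>)"
proof -
  interpret A: cring A by fact
  interpret B: cring B by fact
  note h = ring_hom_memE[OF assms(3)]
  have "abelian_group (restrict_scalars B \<phi>)"
    by (rule abelian_groupI)
      (auto simp: restrict_scalars_def B.a_ac intro: B.l_neg)
  then show ?thesis
    by (intro moduleI assms(1)) (auto simp: restrict_scalars_def h B.l_distr B.r_distr B.m_assoc)
qed

text \<open>The copy of an ideal in the left summand of a sum type. Flatness tests modules on such a
  type only, so this is how an ideal becomes a test module.\<close>

definition ideal_module :: "('a, 'm) ring_scheme \<Rightarrow> 'a set \<Rightarrow> ('a, 'a + 'u) module" where
  "ideal_module A J =
     \<lparr>carrier = Inl ` J,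
      monoid.mult = (\<lambda>x y. Inl (projl x \<otimes>\<^bsub>A\<^esub> projl y)), one = Inl \<one>\<^bsub>A\<^esub>, ring.zero = Inl \<zero>\<^bsub>A\<^esub>,
      ring.add = (\<lambda>x y. Inl (projl x \<oplus>\<^bsub>A\<^esub> projl y)),
      smult = (\<lambda>r x. Inl (r \<otimes>\<^bsub>A\<^esub> projl x))\<rparr>"

lemma ideal_module_simps [simp]:
  "carrier (ideal_module A J) = Inl ` J"
  "\<zero>\<^bsub>ideal_module A J\<^esub> = Inl \<zero>\<^bsub>A\<^esub>"
  "Inl x \<oplus>\<^bsub>ideal_module A J\<^esub> Inl y = Inl (x \<oplus>\<^bsub>A\<^esub> y)"
  "r \<odot>\<^bsub>ideal_module A J\<^esub> Inl x = Inl (r \<otimes>\<^bsub>A\<^esub> x)"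
  by (simp_all add: ideal_module_def)

lemma ideal_module_module:
  assumes "cring A" "ideal J A"
  shows "module A (ideal_module A J)"
proof -
  interpret A: cring A by fact
  interpret J: ideal J A by fact
  have "abelian_group (ideal_module A J)"
  proof (rule abelian_groupI)
    fix x assume "x \<in> carrier (ideal_module A J)"
    then show "\<exists>y\<in>carrier (ideal_module A J). y \<oplus>\<^bsub>ideal_module A J\<^esub> x = \<zero>\<^bsub>ideal_module A J\<^esub>"
      by (auto intro!: bexI[of _ "\<ominus>\<^bsub>A\<^esub> _"] simp: A.l_neg)
  qed (auto simp: A.a_ac)
  then show ?thesis
    by (intro moduleI assms(1))
      (auto simp: J.I_l_closed A.l_distr A.r_distr A.m_assoc)
qed

context
  fixes A :: "('a, 'm) ring_scheme" and I :: "'a set"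
  assumes A: "cring A" and I: "ideal I A"
begin

interpretation A: cring A by (rule A)
interpretation I: ideal I A by (rule I)

lemma quot_module_module: "module A (quot_module A I)"
  using A I.quotient_is_cring[OF A] I.rcos_ring_hom by (rule restrict_scalars_module)

lemma carrier_quot_module: "carrier (quot_module A I) = (\<lambda>a. I +>\<^bsub>A\<^esub> a) ` carrier A"
  by (auto simp: restrict_scalars_def FactRing_simps)

lemma zero_quot_module: "\<zero>\<^bsub>quot_module A I\<^esub> = I"
  by (simp add: restrict_scalars_def FactRing_def)

lemma add_quot_module:
  "a \<in> carrier A \<Longrightarrow> b \<in> carrier A \<Longrightarrow>
     (I +>\<^bsub>A\<^esub> a) \<oplus>\<^bsub>quot_module A I\<^esub> (I +>\<^bsub>A\<^esub> b) = I +>\<^bsub>A\<^esub> (a \<oplus>\<^bsub>A\<^esub> b)"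
  by (simp add: restrict_scalars_def FactRing_def I.a_rcos_sum)

lemma smult_quot_module:
  "r \<in> carrier A \<Longrightarrow> a \<in> carrier A \<Longrightarrow>
     r \<odot>\<^bsub>quot_module A I\<^esub> (I +>\<^bsub>A\<^esub> a) = I +>\<^bsub>A\<^esub> (r \<otimes>\<^bsub>A\<^esub> a)"
  by (simp add: restrict_scalars_def FactRing_def I.rcoset_mult_add)

context
  fixes N :: "('a, 'c, 'n) module_scheme"
  assumes N: "module A N"
begin

interpretation N: module A N by (rule N)
interpretation M: module A "quot_module A I" by (rule quot_module_module)

lemmas null_rules =
  tensor_null_smult_swap[OF quot_module_module N] tensor_null_zero_left[OF quot_module_module N]

text \<open>As $A/I$ is generated by the class of $1$, one has
  $\bar{a} \otimes y = \bar{1} \otimes a y$, and tensors with the same left factor add up.\<close>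

lemma ex_pure_tensor:
  assumes "c \<in> carrier (tensor_free (quot_module A I) N)"
  shows "\<exists>y \<in> carrier N. c - frag_of (I +>\<^bsub>A\<^esub> \<one>\<^bsub>A\<^esub>, y) \<in> tensor_null A (quot_module A I) N"
proof -
  let ?K = "tensor_null A (quot_module A I) N" and ?e = "I +>\<^bsub>A\<^esub> \<one>\<^bsub>A\<^esub>"
  note K_diff = tensor_null_diff[OF quot_module_module N]
  have e: "?e \<in> carrier (quot_module A I)"
    by (auto simp: carrier_quot_module)
  from assms have "Poly_Mapping.keys c \<subseteq> carrier (quot_module A I) \<times> carrier N"
    by simp
  then show ?thesis
  proof (induction c rule: free_Abelian_group_induct[consumes 1])
    case 1
    have "0 - frag_of (?e, \<zero>\<^bsub>N\<^esub>) \<in> ?K"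
      using tensor_null_uminus[OF quot_module_module N tensor_null_zero_right[OF quot_module_module N e]]
      by simp
    then show ?case
      by blast
  next
    case (2 c d)
    then obtain y z where y: "y \<in> carrier N" "c - frag_of (?e, y) \<in> ?K"
      and z: "z \<in> carrier N" "d - frag_of (?e, z) \<in> ?K"
      by blast
    have "(c - frag_of (?e, y)) - (d - frag_of (?e, z))
        + (frag_of (?e, y) - frag_of (?e, z) - frag_of (?e, y \<ominus>\<^bsub>N\<^esub> z)) \<in> ?K"
      by (rule tensor_null_add[OF quot_module_module N K_diff[OF y(2) z(2)]
            tensor_null_diff_right[OF quot_module_module N e y(1) z(1)]])
    then have "(c - d) - frag_of (?e, y \<ominus>\<^bsub>N\<^esub> z) \<in> ?K"
      by (simp add: algebra_simps)
    with y(1) z(1) show ?case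
      by blast
  next
    case (3 p)
    then obtain a y where p: "p = (I +>\<^bsub>A\<^esub> a, y)" and ay: "a \<in> carrier A" "y \<in> carrier N"
      by (auto simp: carrier_quot_module)
    have "frag_of (a \<odot>\<^bsub>quot_module A I\<^esub> ?e, y) - frag_of (?e, a \<odot>\<^bsub>N\<^esub> y) \<in> ?K"
      using ay e by (intro null_rules)
    then show ?case
      using ay by (auto simp: p smult_quot_module)
  qed
qed

lemma annihilated_imp_null:
  assumes e: "e \<in> I" and y: "y \<in> carrier N"
  shows "frag_of (I +>\<^bsub>A\<^esub> \<one>\<^bsub>A\<^esub>, e \<odot>\<^bsub>N\<^esub> y) \<in> tensor_null A (quot_module A I) N"
proof -
  let ?K = "tensor_null A (quot_module A I) N" and ?e = "I +>\<^bsub>A\<^esub> \<one>\<^bsub>A\<^esub>"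
  have "?e \<in> carrier (quot_module A I)"
    by (auto simp: carrier_quot_module)
  then have "frag_of (e \<odot>\<^bsub>quot_module A I\<^esub> ?e, y) - frag_of (?e, e \<odot>\<^bsub>N\<^esub> y) \<in> ?K"
    using e y I.Icarr by (intro null_rules) auto
  moreover have "e \<odot>\<^bsub>quot_module A I\<^esub> ?e = \<zero>\<^bsub>quot_module A I\<^esub>"
    using e I.Icarr by (simp add: smult_quot_module zero_quot_module A.a_rcos_zero[OF I])
  ultimately have "frag_of (\<zero>\<^bsub>quot_module A I\<^esub>, y) - frag_of (?e, e \<odot>\<^bsub>N\<^esub> y) \<in> ?K"
    by simp
  then show ?thesis
    using tensor_null_diff_left[OF quot_module_module N] null_rules(2)[OF y] by blast
qed

text \<open>This is the half of the isomorphism $A/I \otimes N \cong N/IN$ that needs a construction: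
  the map $\bar{a} \otimes y \mapsto a y$. It is defined on the free abelian group with arbitrarily
  chosen representatives $a$; changing a representative changes the value by an element of $T$ only,
  so the relations are sent into $T$. Keeping $T$ general avoids the quotient module $N/IN$.\<close>

lemma null_imp_mem_subgroup:
  assumes T: "subgroup T (add_monoid N)"
    and IN: "\<And>i x. i \<in> I \<Longrightarrow> x \<in> carrier N \<Longrightarrow> i \<odot>\<^bsub>N\<^esub> x \<in> T"
    and y: "y \<in> carrier N"
    and null: "frag_of (I +>\<^bsub>A\<^esub> \<one>\<^bsub>A\<^esub>, y) \<in> tensor_null A (quot_module A I) N"
  shows "y \<in> T"
proof -
  let ?M = "quot_module A I"
  have Tc: "x \<in> carrier N" if "x \<in> T" for x
    using subgroup.mem_carrier[OF T that] by simp
  have Tadd: "x \<oplus>\<^bsub>N\<^esub> z \<in> T" if "x \<in> T" "z \<in> T" for x z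
    using subgroup.m_closed[OF T that] by simp
  have Tneg: "\<ominus>\<^bsub>N\<^esub> x \<in> T" if "x \<in> T" for x
    using subgroup.m_inv_closed[OF T that] by (simp add: a_inv_def)
  have T0: "\<zero>\<^bsub>N\<^esub> \<in> T"
    using subgroup.one_closed[OF T] by simp
  define rep where "rep X = (SOME a. a \<in> carrier A \<and> X = I +>\<^bsub>A\<^esub> a)" for X
  have rep: "rep X \<in> carrier A" "I +>\<^bsub>A\<^esub> rep X = X" if "X \<in> carrier ?M" for X
    using someI_ex[of "\<lambda>a. a \<in> carrier A \<and> X = I +>\<^bsub>A\<^esub> a"] that
    unfolding rep_def by (auto simp: carrier_quot_module)
  \<comment> \<open>Modulo \<open>T\<close> the action of a ring element depends only on its class modulo \<open>I\<close>.\<close>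
  have congr: "a \<odot>\<^bsub>N\<^esub> x \<ominus>\<^bsub>N\<^esub> b \<odot>\<^bsub>N\<^esub> x \<in> T"
    if "a \<in> carrier A" "b \<in> carrier A" "I +>\<^bsub>A\<^esub> a = I +>\<^bsub>A\<^esub> b" "x \<in> carrier N" for a b x
  proof -
    have "a \<ominus>\<^bsub>A\<^esub> b \<in> I"
      using that A.quotient_eq_iff_same_a_r_cos[OF I] by simp
    then have "(a \<ominus>\<^bsub>A\<^esub> b) \<odot>\<^bsub>N\<^esub> x \<in> T"
      using IN that(4) by blast
    also have "(a \<ominus>\<^bsub>A\<^esub> b) \<odot>\<^bsub>N\<^esub> x = a \<odot>\<^bsub>N\<^esub> x \<ominus>\<^bsub>N\<^esub> b \<odot>\<^bsub>N\<^esub> x"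
      using that by (simp add: a_minus_def N.smult_l_distr N.smult_l_minus)
    finally show ?thesis .
  qed
  obtain h where h: "h \<in> hom (tensor_free ?M N) (add_monoid N)"
    and h_of: "\<And>X x. X \<in> carrier ?M \<Longrightarrow> x \<in> carrier N \<Longrightarrow> h (frag_of (X, x)) = rep X \<odot>\<^bsub>N\<^esub> x"
  proof (rule comm_group.free_Abelian_group_universal[OF N.a_comm_group, of "\<lambda>(X, x). rep X \<odot>\<^bsub>N\<^esub> x" "carrier ?M \<times> carrier N"])
    show "(\<lambda>(X, x). rep X \<odot>\<^bsub>N\<^esub> x) ` (carrier ?M \<times> carrier N) \<subseteq> carrier (add_monoid N)"
      using rep by auto
  qed (auto simp: tensor_free_def intro: that)
  interpret h: group_hom "tensor_free ?M N" "add_monoid N" h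
    using h comm_group.axioms(2)[OF N.a_comm_group] by (simp add: group_hom_def group_hom_axioms_def)
  have h_diff: "h (c - d) = h c \<ominus>\<^bsub>N\<^esub> h d"
    if "c \<in> carrier (tensor_free ?M N)" "d \<in> carrier (tensor_free ?M N)" for c d
    using h.hom_mult[of c "- d"] h.hom_inv[of d] that
    by (simp add: inv_tensor_free a_minus_def a_inv_def)
  let ?S = "{c \<in> carrier (tensor_free ?M N). h c \<in> T}"
  have "subgroup ?S (tensor_free ?M N)"
  proof (rule group.subgroupI)
    show "?S \<noteq> {}"
      using h.hom_one T0 by (auto intro!: exI[of _ 0])
    show "inv\<^bsub>tensor_free ?M N\<^esub> c \<in> ?S" if "c \<in> ?S" for c
      using that h.hom_inv[of c] Tneg by (auto simp: inv_tensor_free a_inv_def)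
    show "c \<otimes>\<^bsub>tensor_free ?M N\<^esub> d \<in> ?S" if "c \<in> ?S" "d \<in> ?S" for c d
      using that h.hom_mult[of c d] Tadd keys_add[of c d] by auto
  qed auto
  moreover have "tensor_relators A ?M N \<subseteq> ?S"
  proof (rule tensor_relators_subsetI)
    fix X Y z assume *: "X \<in> carrier ?M" "Y \<in> carrier ?M" "z \<in> carrier N"
    have XY: "X \<oplus>\<^bsub>?M\<^esub> Y \<in> carrier ?M"
      using * by auto
    have "rep (X \<oplus>\<^bsub>?M\<^esub> Y) \<odot>\<^bsub>N\<^esub> z \<ominus>\<^bsub>N\<^esub> (rep X \<oplus>\<^bsub>A\<^esub> rep Y) \<odot>\<^bsub>N\<^esub> z \<in> T"
    proof (rule congr)
      show "I +>\<^bsub>A\<^esub> rep (X \<oplus>\<^bsub>?M\<^esub> Y) = I +>\<^bsub>A\<^esub> (rep X \<oplus>\<^bsub>A\<^esub> rep Y)"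
        using add_quot_module[of "rep X" "rep Y"] rep(2)[OF XY] * by (simp add: rep)
    qed (use * rep(1) XY in simp_all)
    then show "frag_of (X \<oplus>\<^bsub>?M\<^esub> Y, z) - frag_of (X, z) - frag_of (Y, z) \<in> ?S"
      using * XY rep(1) by (simp add: keys_diff_subset h_diff h_of N.smult_l_distr a_minus_def
          N.minus_add N.a_assoc)
  next
    fix X y z assume *: "X \<in> carrier ?M" "y \<in> carrier N" "z \<in> carrier N"
    have "rep X \<odot>\<^bsub>N\<^esub> (y \<oplus>\<^bsub>N\<^esub> z) \<ominus>\<^bsub>N\<^esub> rep X \<odot>\<^bsub>N\<^esub> y \<ominus>\<^bsub>N\<^esub> rep X \<odot>\<^bsub>N\<^esub> z = \<zero>\<^bsub>N\<^esub>"
    proof -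
      have "rep X \<odot>\<^bsub>N\<^esub> (y \<oplus>\<^bsub>N\<^esub> z) \<ominus>\<^bsub>N\<^esub> rep X \<odot>\<^bsub>N\<^esub> y \<ominus>\<^bsub>N\<^esub> rep X \<odot>\<^bsub>N\<^esub> z =
          rep X \<odot>\<^bsub>N\<^esub> (y \<oplus>\<^bsub>N\<^esub> z) \<oplus>\<^bsub>N\<^esub> \<ominus>\<^bsub>N\<^esub> (rep X \<odot>\<^bsub>N\<^esub> y \<oplus>\<^bsub>N\<^esub> rep X \<odot>\<^bsub>N\<^esub> z)"
        using * rep(1)[OF *(1)] by (simp add: a_minus_def N.a_assoc N.minus_add)
      then show ?thesis
        using * rep(1)[OF *(1)] by (simp add: N.smult_r_distr N.r_neg)
    qed
    then show "frag_of (X, y \<oplus>\<^bsub>N\<^esub> z) - frag_of (X, y) - frag_of (X, z) \<in> ?S"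
      using * T0 by (simp add: keys_diff_subset h_diff h_of)
  next
    fix r X y assume *: "r \<in> carrier A" "X \<in> carrier ?M" "y \<in> carrier N"
    have rX: "r \<odot>\<^bsub>?M\<^esub> X \<in> carrier ?M"
      using * by auto
    have "rep (r \<odot>\<^bsub>?M\<^esub> X) \<odot>\<^bsub>N\<^esub> y \<ominus>\<^bsub>N\<^esub> (rep X \<otimes>\<^bsub>A\<^esub> r) \<odot>\<^bsub>N\<^esub> y \<in> T"
    proof (rule congr)
      show "I +>\<^bsub>A\<^esub> rep (r \<odot>\<^bsub>?M\<^esub> X) = I +>\<^bsub>A\<^esub> (rep X \<otimes>\<^bsub>A\<^esub> r)"
        using smult_quot_module[of r "rep X"] rep(2)[OF rX] * by (simp add: rep A.m_comm)
    qed (use * rep(1) rX in simp_all)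
    then show "frag_of (r \<odot>\<^bsub>?M\<^esub> X, y) - frag_of (X, r \<odot>\<^bsub>N\<^esub> y) \<in> ?S"
      using * rX rep(1) by (simp add: keys_diff_subset h_diff h_of N.smult_assoc1)
  qed
  ultimately have "tensor_null A ?M N \<subseteq> ?S"
    unfolding tensor_null_def by (intro group.generate_subgroup_incl) auto
  moreover have e: "I +>\<^bsub>A\<^esub> \<one>\<^bsub>A\<^esub> \<in> carrier ?M"
    by (auto simp: carrier_quot_module)
  ultimately have "rep (I +>\<^bsub>A\<^esub> \<one>\<^bsub>A\<^esub>) \<odot>\<^bsub>N\<^esub> y \<in> T"
    using null h_of y by auto
  moreover have "\<one>\<^bsub>A\<^esub> \<odot>\<^bsub>N\<^esub> y \<ominus>\<^bsub>N\<^esub> rep (I +>\<^bsub>A\<^esub> \<one>\<^bsub>A\<^esub>) \<odot>\<^bsub>N\<^esub> y \<in> T"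
    using rep[OF e] y by (intro congr) auto
  ultimately have "(\<one>\<^bsub>A\<^esub> \<odot>\<^bsub>N\<^esub> y \<ominus>\<^bsub>N\<^esub> rep (I +>\<^bsub>A\<^esub> \<one>\<^bsub>A\<^esub>) \<odot>\<^bsub>N\<^esub> y) \<oplus>\<^bsub>N\<^esub> rep (I +>\<^bsub>A\<^esub> \<one>\<^bsub>A\<^esub>) \<odot>\<^bsub>N\<^esub> y \<in> T"
    by (intro Tadd)
  then show ?thesis
    using rep[OF e] y by (simp add: a_minus_def N.a_assoc N.l_neg)
qed

end

end

section \<open>Pure ideals\<close>

text \<open>The witness $e + d - d e$ satisfies $1 - c = (1 - d)(1 - e)$, and hence $1 - c$ kills whatever
  $1 - e$ or $1 - d$ kills.\<close>

lemma common_fixing_element: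
  assumes "module A N" "ideal I A" and y: "y \<in> carrier N" "z \<in> carrier N"
    and e: "e \<in> I" "e \<odot>\<^bsub>N\<^esub> y = y" and d: "d \<in> I" "d \<odot>\<^bsub>N\<^esub> z = z"
  obtains c where "c \<in> I" "c \<odot>\<^bsub>N\<^esub> y = y" "c \<odot>\<^bsub>N\<^esub> z = z"
proof -
  interpret N: module A N by fact
  interpret I: ideal I A by fact
  have c: "e \<in> carrier A" "d \<in> carrier A"
    using e d I.Icarr by auto
  let ?c = "e \<oplus>\<^bsub>A\<^esub> d \<ominus>\<^bsub>A\<^esub> d \<otimes>\<^bsub>A\<^esub> e"
  have swap: "e \<oplus>\<^bsub>A\<^esub> d \<ominus>\<^bsub>A\<^esub> d \<otimes>\<^bsub>A\<^esub> e = d \<oplus>\<^bsub>A\<^esub> e \<ominus>\<^bsub>A\<^esub> e \<otimes>\<^bsub>A\<^esub> d"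
    using c by (simp add: N.R.m_comm N.R.a_comm)
  have absorb: "(e \<oplus>\<^bsub>A\<^esub> d \<ominus>\<^bsub>A\<^esub> d \<otimes>\<^bsub>A\<^esub> e) \<odot>\<^bsub>N\<^esub> y = y"
    if "e \<in> carrier A" "d \<in> carrier A" "e \<odot>\<^bsub>N\<^esub> y = y" "y \<in> carrier N" for e d y
  proof -
    have "(e \<oplus>\<^bsub>A\<^esub> d \<ominus>\<^bsub>A\<^esub> d \<otimes>\<^bsub>A\<^esub> e) \<odot>\<^bsub>N\<^esub> y = e \<odot>\<^bsub>N\<^esub> y \<oplus>\<^bsub>N\<^esub> d \<odot>\<^bsub>N\<^esub> y \<oplus>\<^bsub>N\<^esub> \<ominus>\<^bsub>N\<^esub> (d \<odot>\<^bsub>N\<^esub> (e \<odot>\<^bsub>N\<^esub> y))"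
      using that(1,2,4)
      by (simp add: a_minus_def N.smult_l_distr N.smult_l_minus N.smult_assoc1)
    also have "\<dots> = y"
      using that by (simp add: N.M.a_assoc N.M.r_neg)
    finally show ?thesis .
  qed
  have "?c \<in> I"
    using e(1) d(1) c I.I_l_closed by (simp add: a_minus_def)
  moreover have "?c \<odot>\<^bsub>N\<^esub> y = y"
    using absorb c e y by blast
  moreover have "?c \<odot>\<^bsub>N\<^esub> z = z"
    unfolding swap using absorb c d y by blast
  ultimately show ?thesis
    by (rule that)
qed

text \<open>For an ideal whose elements are fixed by elements of the ideal, this subgroup is the
  submodule $I N$, in a form that an injective linear map reflects.\<close>

lemma subgroup_fixed_by_ideal:
  assumes "module A N" "ideal I A"
  shows "subgroup {y \<in> carrier N. \<exists>e\<in>I. e \<odot>\<^bsub>N\<^esub> y = y} (add_monoid N)" (is "subgroup ?T _")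
proof -
  interpret N: module A N by fact
  interpret I: ideal I A by fact
  show ?thesis
  proof (rule group.subgroupI[OF N.M.a_group])
    show "?T \<noteq> {}"
      using I.zero_closed by (auto intro!: exI[of _ "\<zero>\<^bsub>N\<^esub>"] bexI[of _ "\<zero>\<^bsub>A\<^esub>"])
    fix y assume "y \<in> ?T"
    then obtain e where y: "y \<in> carrier N" and e: "e \<in> I" "e \<odot>\<^bsub>N\<^esub> y = y"
      by blast
    have "e \<odot>\<^bsub>N\<^esub> (\<ominus>\<^bsub>N\<^esub> y) = \<ominus>\<^bsub>N\<^esub> y"
      using y e I.Icarr by (simp add: N.smult_r_minus)
    then show "inv\<^bsub>add_monoid N\<^esub> y \<in> ?T"
      using y e unfolding a_inv_def[symmetric] by auto
    fix z assume "z \<in> ?T"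
    then obtain d where z: "z \<in> carrier N" and d: "d \<in> I" "d \<odot>\<^bsub>N\<^esub> z = z"
      by blast
    obtain c where "c \<in> I" "c \<odot>\<^bsub>N\<^esub> y = y" "c \<odot>\<^bsub>N\<^esub> z = z"
      by (rule common_fixing_element[OF assms y z e d])
    then show "y \<otimes>\<^bsub>add_monoid N\<^esub> z \<in> ?T"
      using y z I.Icarr by (auto simp: N.smult_r_distr intro!: bexI[of _ c])
  qed auto
qed

text \<open>An element of the kernel is $1 \otimes y$ with $1 \otimes f(y) = 0$. Then $e f(y) = f(y)$ for some
  $e \in I$; injectivity of $f$ gives $e y = y$, and $1 \otimes e y = \bar{e} \otimes y = 0$.\<close>

lemma flat_quotient_if_local_units:
  assumes A: "cring A" and I: "ideal I A" and unit: "\<And>a. a \<in> I \<Longrightarrow> \<exists>e\<in>I. e \<otimes>\<^bsub>A\<^esub> a = a"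
  shows "flat_module U A (quot_module A I)"
  unfolding flat_module_def
proof (intro conjI allI impI, goal_cases)
  case 1
  show ?case
    using A I by (rule quot_module_module)
next
  case (2 N N' f)
  then have N: "module A N" and N': "module A N'" and f: "f \<in> module_homs A N N'"
    and inj: "inj_on f (carrier N)"
    by auto
  interpret N: module A N by (rule N)
  interpret N': module A N' by (rule N')
  interpret I: ideal I A by (rule I)
  let ?M = "quot_module A I" and ?e = "I +>\<^bsub>A\<^esub> \<one>\<^bsub>A\<^esub>"
  let ?T = "{y \<in> carrier N'. \<exists>e\<in>I. e \<odot>\<^bsub>N'\<^esub> y = y}"
  note M = quot_module_module[OF A I]
  show ?case
    unfolding inj_on_tensor_map_iff[OF M N N' f]
  proof (intro ballI impI)
    fix c assume c: "c \<in> carrier (tensor_free ?M N)"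
      and Fc: "frag_map_right f c \<in> tensor_null A ?M N'"
    obtain y where y: "y \<in> carrier N" and cy: "c - frag_of (?e, y) \<in> tensor_null A ?M N"
      using ex_pure_tensor[OF A I N c] by blast
    have fy: "f y \<in> carrier N'"
      using f y by (auto simp: module_homs_def)
    have "frag_map_right f c - frag_of (?e, f y) \<in> tensor_null A ?M N'"
      using frag_map_right_null[OF M N N' f cy] by (simp add: frag_extend_diff)
    then have "frag_of (?e, f y) \<in> tensor_null A ?M N'"
      using tensor_null_diff_left[OF M N'] Fc by blast
    moreover have "i \<odot>\<^bsub>N'\<^esub> x \<in> ?T" if ix: "i \<in> I" "x \<in> carrier N'" for i x
    proof -
      obtain e where e: "e \<in> I" "e \<otimes>\<^bsub>A\<^esub> i = i"
        using unit ix by blast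
      then have "e \<odot>\<^bsub>N'\<^esub> (i \<odot>\<^bsub>N'\<^esub> x) = i \<odot>\<^bsub>N'\<^esub> x"
        using ix I.Icarr by (simp flip: N'.smult_assoc1)
      with e(1) ix I.Icarr show ?thesis
        by auto
    qed
    ultimately have "f y \<in> ?T"
      using null_imp_mem_subgroup[OF A I N' subgroup_fixed_by_ideal[OF N' I] _ fy] by blast
    then obtain e where e: "e \<in> I" "e \<odot>\<^bsub>N'\<^esub> f y = f y"
      by blast
    have "f (e \<odot>\<^bsub>N\<^esub> y) = f y"
      using f e y I.Icarr by (simp add: module_homs_def)
    then have "e \<odot>\<^bsub>N\<^esub> y = y"
      using inj e(1) y I.Icarr by (auto dest: inj_onD)
    then have "frag_of (?e, y) \<in> tensor_null A ?M N"
      using annihilated_imp_null[OF A I N e(1) y] by simp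
    then show "c \<in> tensor_null A ?M N"
      using tensor_null_diff_left[OF M N cy] by blast
  qed
qed

text \<open>Flatness is used for a single map, the inclusion of $aA$ into $A$. In $A/I \otimes A$ the
  tensor $1 \otimes a = \bar{a} \otimes 1$ vanishes, which is not visible in $A/I \otimes aA$ since $1$ need
  not lie in $aA$.\<close>

lemma local_unit_if_flat_quotient:
  fixes A :: "('a, 'm) ring_scheme" and U :: "'u itself"
  assumes A: "cring A" and I: "ideal I A" and flat: "flat_module U A (quot_module A I)"
    and a: "a \<in> I"
  shows "\<exists>e\<in>I. e \<otimes>\<^bsub>A\<^esub> a = a"
proof -
  interpret A: cring A by (rule A)
  interpret I: ideal I A by (rule I)
  have ac: "a \<in> carrier A"
    using a by (rule I.Icarr)
  have J: "ideal (PIdl\<^bsub>A\<^esub> a) A"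
    using ac by (rule A.cgenideal_ideal)
  have aJ: "a \<in> PIdl\<^bsub>A\<^esub> a"
    using ac by (rule A.cgenideal_self)
  let ?M = "quot_module A I" and ?e = "I +>\<^bsub>A\<^esub> \<one>\<^bsub>A\<^esub>"
  define N :: "('a, 'a + 'u) module" where "N = ideal_module A (PIdl\<^bsub>A\<^esub> a)"
  define N' :: "('a, 'a + 'u) module" where "N' = ideal_module A (carrier A)"
  note M = quot_module_module[OF A I]
  have N: "module A N" and N': "module A N'"
    unfolding N_def N'_def using A J A.oneideal by (auto intro: ideal_module_module)
  have incl: "id \<in> module_homs A N N'"
    using ideal.Icarr[OF J] by (auto simp: module_homs_def N_def N'_def)
  have "inj_on (tensor_map A ?M N' id) (carrier (tensor_group A ?M N))"
    using flat N N' incl unfolding flat_module_def by auto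
  then have ker: "c \<in> tensor_null A ?M N"
    if "c \<in> carrier (tensor_free ?M N)" "frag_map_right id c \<in> tensor_null A ?M N'" for c
    using that unfolding inj_on_tensor_map_iff[OF M N N' incl] by blast
  \<comment> \<open>Here \<open>a\<close> acts on the unit \<open>\<one>\<close> of \<open>A\<close>, an element of \<open>N'\<close>.\<close>
  have "frag_of (?e, Inl a) \<in> tensor_null A ?M N'"
    using annihilated_imp_null[OF A I N' a, of "Inl \<one>\<^bsub>A\<^esub>"] ac by (simp add: N'_def)
  then have null: "frag_of (?e, Inl a) \<in> tensor_null A ?M N"
    using aJ by (intro ker) (auto simp: N_def carrier_quot_module[OF A I])
  let ?T = "Inl ` {x \<otimes>\<^bsub>A\<^esub> a | x. x \<in> I} :: ('a + 'u) set"
  interpret N: module A N by (rule N)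
  have neg: "\<ominus>\<^bsub>N\<^esub> Inl x = Inl (\<ominus>\<^bsub>A\<^esub> x)" if "x \<in> PIdl\<^bsub>A\<^esub> a" for x
  proof -
    have "\<ominus>\<^bsub>A\<^esub> x \<in> PIdl\<^bsub>A\<^esub> a" "x \<in> carrier A"
      using that J ideal.Icarr[OF J] by (auto intro: additive_subgroup.a_inv_closed ideal.axioms)
    then show ?thesis
      using that by (intro N.M.minus_equality) (auto simp: N_def A.l_neg)
  qed
  have "subgroup ?T (add_monoid N)"
  proof (rule group.subgroupI[OF N.M.a_group])
    have "{x \<otimes>\<^bsub>A\<^esub> a | x. x \<in> I} \<subseteq> PIdl\<^bsub>A\<^esub> a"
      using I.Icarr unfolding cgenideal_def by blast
    then show "?T \<subseteq> carrier (add_monoid N)"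
      by (simp add: N_def image_mono)
    show "?T \<noteq> {}"
      using a by blast
    fix y assume "y \<in> ?T"
    then obtain x where x: "x \<in> I" "y = Inl (x \<otimes>\<^bsub>A\<^esub> a)"
      by blast
    have "x \<otimes>\<^bsub>A\<^esub> a \<in> PIdl\<^bsub>A\<^esub> a"
      using x I.Icarr by (auto simp: cgenideal_def)
    then have "inv\<^bsub>add_monoid N\<^esub> y = Inl ((\<ominus>\<^bsub>A\<^esub> x) \<otimes>\<^bsub>A\<^esub> a)"
      using x ac I.Icarr neg unfolding a_inv_def[of N, symmetric] by (simp add: A.l_minus)
    then show "inv\<^bsub>add_monoid N\<^esub> y \<in> ?T"
      using x by blast
    fix z assume "z \<in> ?T"
    then obtain w where w: "w \<in> I" "z = Inl (w \<otimes>\<^bsub>A\<^esub> a)"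
      by blast
    have "y \<otimes>\<^bsub>add_monoid N\<^esub> z = Inl ((x \<oplus>\<^bsub>A\<^esub> w) \<otimes>\<^bsub>A\<^esub> a)"
      using x w ac I.Icarr by (simp add: N_def A.l_distr)
    then show "y \<otimes>\<^bsub>add_monoid N\<^esub> z \<in> ?T"
      using x w by blast
  qed
  moreover have "i \<odot>\<^bsub>N\<^esub> y \<in> ?T" if iy: "i \<in> I" "y \<in> carrier N" for i y
  proof -
    obtain r where r: "r \<in> carrier A" "y = Inl (r \<otimes>\<^bsub>A\<^esub> a)"
      using iy(2) by (auto simp: N_def cgenideal_def)
    have "i \<odot>\<^bsub>N\<^esub> y = Inl ((i \<otimes>\<^bsub>A\<^esub> r) \<otimes>\<^bsub>A\<^esub> a)"
      using r ac I.Icarr[OF iy(1)] by (simp add: N_def A.m_assoc)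
    then show ?thesis
      using I.I_r_closed[OF iy(1) r(1)] by blast
  qed
  moreover have "Inl a \<in> carrier N"
    using aJ by (simp add: N_def)
  ultimately have "Inl a \<in> ?T"
    using null_imp_mem_subgroup[OF A I N _ _ _ null] by blast
  then obtain e where "e \<in> I" "a = e \<otimes>\<^bsub>A\<^esub> a"
    by blast
  then show ?thesis
    by force
qed

lemma pure_ideal_iff_local_units:
  assumes "cring A"
  shows "pure_ideal U A I \<longleftrightarrow> ideal I A \<and> (\<forall>a\<in>I. \<exists>e\<in>I. e \<otimes>\<^bsub>A\<^esub> a = a)"
  unfolding pure_ideal_def flat_ring_hom_def
  using flat_quotient_if_local_units[OF assms, of I U] local_unit_if_flat_quotient[OF assms, of I U]
    ideal.rcos_ring_hom[of I A]
  by blast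

section \<open>Prime and maximal ideals\<close>

lemma (in ring) idealI_elementwise:
  assumes "I \<subseteq> carrier R" "\<zero> \<in> I"
    and "\<And>x y. x \<in> I \<Longrightarrow> y \<in> I \<Longrightarrow> x \<oplus> y \<in> I"
    and "\<And>r x. r \<in> carrier R \<Longrightarrow> x \<in> I \<Longrightarrow> r \<otimes> x \<in> I"
    and "\<And>r x. r \<in> carrier R \<Longrightarrow> x \<in> I \<Longrightarrow> x \<otimes> r \<in> I"
  shows "ideal I R"
proof (rule idealI[OF ring_axioms])
  have "\<ominus> x \<in> I" if "x \<in> I" for x
    using assms(1) assms(4)[of "\<ominus> \<one>" x] that by (auto simp: l_minus subset_iff)
  then show "subgroup I (add_monoid R)"
    using assms(1,2,3) by (intro add.subgroupI) (auto simp: a_inv_def)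
qed (use assms in auto)

lemma (in cring) annihilator_ideal:
  assumes "a \<in> carrier R"
  shows "ideal {x \<in> carrier R. x \<otimes> a = \<zero>} R"
proof (rule idealI_elementwise)
  fix r x assume *: "r \<in> carrier R" "x \<in> {x \<in> carrier R. x \<otimes> a = \<zero>}"
  then have "(r \<otimes> x) \<otimes> a = r \<otimes> (x \<otimes> a)"
    using assms by (simp add: m_assoc)
  with * show "r \<otimes> x \<in> {x \<in> carrier R. x \<otimes> a = \<zero>}"
    by simp
  with * show "x \<otimes> r \<in> {x \<in> carrier R. x \<otimes> a = \<zero>}"
    by (simp add: m_comm)
qed (use assms in \<open>auto simp: l_distr\<close>)

lemma (in ring) ideal_Union_chain:
  assumes "\<C> \<noteq> {}" "subset.chain \<A> \<C>" and "\<And>I. I \<in> \<C> \<Longrightarrow> ideal I R"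
  shows "ideal (\<Union>\<C>) R"
proof (rule idealI_elementwise)
  have I: "I \<subseteq> carrier R" "\<zero> \<in> I" "\<And>x y. x \<in> I \<Longrightarrow> y \<in> I \<Longrightarrow> x \<oplus> y \<in> I"
    "\<And>r x. r \<in> carrier R \<Longrightarrow> x \<in> I \<Longrightarrow> r \<otimes> x \<in> I"
    "\<And>r x. r \<in> carrier R \<Longrightarrow> x \<in> I \<Longrightarrow> x \<otimes> r \<in> I"
    if "I \<in> \<C>" for I
    using assms(3)[OF that]
    by (auto simp: ideal.Icarr additive_subgroup.zero_closed ideal.axioms
          additive_subgroup.a_closed ideal.I_l_closed ideal.I_r_closed)
  show "\<Union>\<C> \<subseteq> carrier R" "\<zero> \<in> \<Union>\<C>"
    using I(1,2) assms(1) by blast+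
  fix x y assume "x \<in> \<Union>\<C>" "y \<in> \<Union>\<C>"
  then obtain I J where *: "x \<in> I" "I \<in> \<C>" "y \<in> J" "J \<in> \<C>"
    by blast
  then have "I \<subseteq> J \<or> J \<subseteq> I"
    using assms(2) unfolding subset.chain_def by blast
  with * show "x \<oplus> y \<in> \<Union>\<C>"
    using I(3) by blast
next
  fix r x assume "r \<in> carrier R" "x \<in> \<Union>\<C>"
  then show "r \<otimes> x \<in> \<Union>\<C>" "x \<otimes> r \<in> \<Union>\<C>"
    using assms(3) ideal.I_l_closed ideal.I_r_closed by fastforce+
qed

text \<open>Krull's separation lemma: an ideal maximal among those disjoint from a multiplicative set is
  prime. The maximality is part of the conclusion, since for the multiplicative set $\{1\}$ it says
  that the prime ideal is a maximal ideal.\<close>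

lemma (in cring) ex_prime_avoiding:
  assumes S: "S \<subseteq> carrier R" "\<one> \<in> S" "\<And>x y. x \<in> S \<Longrightarrow> y \<in> S \<Longrightarrow> x \<otimes> y \<in> S"
    and I: "ideal I R" "I \<inter> S = {}"
  obtains P where "primeideal P R" "I \<subseteq> P" "P \<inter> S = {}"
    "\<And>J. ideal J R \<Longrightarrow> J \<inter> S = {} \<Longrightarrow> P \<subseteq> J \<Longrightarrow> J = P"
proof -
  let ?\<A> = "{J. ideal J R \<and> I \<subseteq> J \<and> J \<inter> S = {}}"
  have "\<exists>P\<in>?\<A>. \<forall>J\<in>?\<A>. P \<subseteq> J \<longrightarrow> J = P"
  proof (rule subset_Zorn_nonempty)
    show "?\<A> \<noteq> {}"
      using I by blast
    fix \<C> assume C: "\<C> \<noteq> {}" "subset.chain ?\<A> \<C>"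
    then have sub: "\<C> \<subseteq> ?\<A>"
      by (simp add: subset.chain_def)
    with C have "ideal (\<Union>\<C>) R"
      by (intro ideal_Union_chain) auto
    moreover have "I \<subseteq> \<Union>\<C>" "\<Union>\<C> \<inter> S = {}"
      using sub C(1) by blast+
    ultimately show "\<Union>\<C> \<in> ?\<A>"
      by simp
  qed
  then obtain P where P: "ideal P R" "I \<subseteq> P" "P \<inter> S = {}"
    and maxP: "\<And>J. ideal J R \<Longrightarrow> J \<inter> S = {} \<Longrightarrow> P \<subseteq> J \<Longrightarrow> J = P"
    by auto
  interpret P: ideal P R by fact
  have meets: "\<exists>p\<in>P. \<exists>r\<in>carrier R. p \<oplus> r \<otimes> a \<in> S" if a: "a \<in> carrier R" "a \<notin> P" for a
  proof -
    have J: "ideal (P <+>\<^bsub>R\<^esub> PIdl a) R"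
      using P(1) cgenideal_ideal[OF a(1)] by (rule add_ideals)
    have "x \<in> P <+>\<^bsub>R\<^esub> PIdl a" if "x \<in> P" for x
    proof -
      have "x = x \<oplus> \<zero> \<otimes> a"
        using that a P.Icarr by simp
      then show ?thesis
        using that unfolding set_add_def' cgenideal_def by blast
    qed
    moreover have "a \<in> P <+>\<^bsub>R\<^esub> PIdl a"
    proof -
      have "a = \<zero> \<oplus> \<one> \<otimes> a"
        using a by simp
      then show ?thesis
        using P.zero_closed unfolding set_add_def' cgenideal_def by blast
    qed
    ultimately have "(P <+>\<^bsub>R\<^esub> PIdl a) \<inter> S \<noteq> {}"
      using maxP[OF J] a(2) by blast
    then show ?thesis
      unfolding set_add_def' cgenideal_def by blast
  qed
  have "primeideal P R"
  proof (rule primeidealI[OF P(1) cring_axioms])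
    show "carrier R \<noteq> P"
      using S P(3) by blast
    fix a b assume ab: "a \<in> carrier R" "b \<in> carrier R" "a \<otimes> b \<in> P"
    show "a \<in> P \<or> b \<in> P"
    proof (rule ccontr)
      assume "\<not> (a \<in> P \<or> b \<in> P)"
      then obtain p r q t where *: "p \<in> P" "r \<in> carrier R" "p \<oplus> r \<otimes> a \<in> S"
        "q \<in> P" "t \<in> carrier R" "q \<oplus> t \<otimes> b \<in> S"
        using meets[OF ab(1)] meets[OF ab(2)] by auto
      note c = * P.Icarr[OF *(1)] P.Icarr[OF *(4)] ab
      \<comment> \<open>Every term contains \<open>p\<close>, \<open>q\<close> or \<open>a \<otimes> b\<close>, so a product of two elements of \<open>S\<close> lies in \<open>P\<close>.\<close>
      have "(p \<oplus> r \<otimes> a) \<otimes> (q \<oplus> t \<otimes> b) = (q \<oplus> t \<otimes> b) \<otimes> p \<oplus> (r \<otimes> a) \<otimes> q \<oplus> (r \<otimes> t) \<otimes> (a \<otimes> b)"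
        using c by algebra
      moreover have "\<dots> \<in> P"
        using c by (simp add: P.I_l_closed)
      ultimately show False
        using S(3)[OF *(3,6)] P(3) by auto
    qed
  qed
  with P maxP that show ?thesis
    by blast
qed

lemma (in cring) ex_maximal_above:
  assumes "ideal I R" "\<one> \<notin> I"
  obtains M where "M \<in> MaxSpec R" "I \<subseteq> M"
proof -
  obtain P where P: "primeideal P R" "I \<subseteq> P" "P \<inter> {\<one>} = {}"
    "\<And>J. ideal J R \<Longrightarrow> J \<inter> {\<one>} = {} \<Longrightarrow> P \<subseteq> J \<Longrightarrow> J = P"
    by (rule ex_prime_avoiding[of "{\<one>}" I]) (use assms in auto)
  have "maximalideal P R"
  proof (rule maximalidealI)
    show "ideal P R" "carrier R \<noteq> P"
      using P(1,3) by (auto simp: primeideal_def)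
    fix J assume J: "ideal J R" "P \<subseteq> J" "J \<subseteq> carrier R"
    then show "J = P \<or> J = carrier R"
      using P(4)[of J] ideal.one_imp_carrier[of J R] by blast
  qed
  with P(2) that show ?thesis
    by (auto simp: MaxSpec_def)
qed

lemma (in ring) MaxSpecD:
  assumes "M \<in> MaxSpec R"
  shows "ideal M R" "\<one> \<notin> M"
  using assms maximalideal.I_notcarr[of M R] ideal.one_imp_carrier[of M R]
  by (auto simp: MaxSpec_def maximalideal_def)

lemma (in ring) one_in_maximal_contra:
  assumes "M \<in> MaxSpec R" "x \<in> M" "y \<in> M" "x \<oplus> y = \<one>"
  shows False
  using assms MaxSpecD[OF assms(1)] additive_subgroup.a_closed[of M R x y]
  by (auto simp: ideal.axioms)

lemma (in cring) coprime_decomposition: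
  assumes "ideal I R" "ideal J R"
    and "\<And>M. M \<in> MaxSpec R \<Longrightarrow> I \<subseteq> M \<Longrightarrow> J \<subseteq> M \<Longrightarrow> False"
  obtains x y where "x \<in> I" "y \<in> J" "x \<oplus> y = \<one>"
proof -
  interpret I: ideal I R by fact
  interpret J: ideal J R by fact
  have "\<one> \<in> I <+>\<^bsub>R\<^esub> J"
  proof (rule ccontr)
    assume "\<one> \<notin> I <+>\<^bsub>R\<^esub> J"
    then obtain M where M: "M \<in> MaxSpec R" "I <+>\<^bsub>R\<^esub> J \<subseteq> M"
      using ex_maximal_above[OF add_ideals[OF assms(1,2)]] by blast
    have "x \<in> I <+>\<^bsub>R\<^esub> J" if "x \<in> I" for x
    proof -
      have "x = x \<oplus> \<zero>"
        using I.Icarr[OF that] by simp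
      then show ?thesis
        using that J.zero_closed unfolding set_add_def' by blast
    qed
    moreover have "y \<in> I <+>\<^bsub>R\<^esub> J" if "y \<in> J" for y
    proof -
      have "y = \<zero> \<oplus> y"
        using J.Icarr[OF that] by simp
      then show ?thesis
        using that I.zero_closed unfolding set_add_def' by blast
    qed
    ultimately show False
      using M assms(3)[of M] by blast
  qed
  then obtain x y where "x \<in> I" "y \<in> J" "\<one> = x \<oplus> y"
    unfolding set_add_def' by blast
  then show ?thesis
    using that by simp
qed

section \<open>An elementwise consequence of the Gelfand property\<close>

text \<open>The products $(1 - c u)(1 - d s)$ form a multiplicative set. If $0$ were not among them, some
  prime $P$ would avoid the set. Then $P$ together with $u$ lies in a maximal ideal, for otherwise
  $1 = p + c u$ and $p = 1 - c u$ would belong to both $P$ and the set; and likewise for $s$. As $P$ has a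
  unique maximal ideal above it, that ideal would contain $u + s = 1$.\<close>

lemma gelfand_orthogonal:
  fixes A (structure)
  assumes "cring A" "gelfand_ring A" and us: "u \<in> carrier A" "s \<in> carrier A" "u \<oplus> s = \<one>"
  obtains c d where "c \<in> carrier A" "d \<in> carrier A"
    "(\<one> \<ominus> c \<otimes> u) \<otimes> (\<one> \<ominus> d \<otimes> s) = \<zero>"
proof -
  interpret cring A by fact
  let ?S = "{(\<one> \<ominus> c \<otimes> u) \<otimes> (\<one> \<ominus> d \<otimes> s) | c d. c \<in> carrier A \<and> d \<in> carrier A}"
  have S_sub: "?S \<subseteq> carrier A"
    using us by auto
  have S_left: "\<one> \<ominus> c \<otimes> u \<in> ?S" if "c \<in> carrier A" for c
  proof -
    have "\<one> \<ominus> c \<otimes> u = (\<one> \<ominus> c \<otimes> u) \<otimes> (\<one> \<ominus> \<zero> \<otimes> s)"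
      using that us by (simp add: a_minus_def)
    then show ?thesis
      using that by blast
  qed
  have S_right: "\<one> \<ominus> d \<otimes> s \<in> ?S" if "d \<in> carrier A" for d
  proof -
    have "\<one> \<ominus> d \<otimes> s = (\<one> \<ominus> \<zero> \<otimes> u) \<otimes> (\<one> \<ominus> d \<otimes> s)"
      using that us by (simp add: a_minus_def)
    then show ?thesis
      using that by blast
  qed
  have S_one: "\<one> \<in> ?S"
    using S_left[OF zero_closed] us by (simp add: a_minus_def)
  have S_mult: "x \<otimes> y \<in> ?S" if "x \<in> ?S" "y \<in> ?S" for x y
  proof -
    from that obtain c d c' d' where cd: "c \<in> carrier A" "d \<in> carrier A" "c' \<in> carrier A" "d' \<in> carrier A"
      and x: "x = (\<one> \<ominus> c \<otimes> u) \<otimes> (\<one> \<ominus> d \<otimes> s)"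
      and y: "y = (\<one> \<ominus> c' \<otimes> u) \<otimes> (\<one> \<ominus> d' \<otimes> s)"
      by auto
    \<comment> \<open>The set \<open>1 + vA\<close> is closed under products; this is applied to \<open>u\<close> and to \<open>s\<close> separately.\<close>
    have merge: "(\<one> \<ominus> c \<otimes> v) \<otimes> (\<one> \<ominus> c' \<otimes> v) = \<one> \<ominus> (c \<oplus> c' \<ominus> c \<otimes> c' \<otimes> v) \<otimes> v"
      if "c \<in> carrier A" "c' \<in> carrier A" "v \<in> carrier A" for c c' v
      using that by algebra
    have "x \<otimes> y = ((\<one> \<ominus> c \<otimes> u) \<otimes> (\<one> \<ominus> c' \<otimes> u)) \<otimes> ((\<one> \<ominus> d \<otimes> s) \<otimes> (\<one> \<ominus> d' \<otimes> s))"
      unfolding x y using cd us(1,2) by (simp add: m_ac)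
    also have "\<dots> = (\<one> \<ominus> (c \<oplus> c' \<ominus> c \<otimes> c' \<otimes> u) \<otimes> u) \<otimes> (\<one> \<ominus> (d \<oplus> d' \<ominus> d \<otimes> d' \<otimes> s) \<otimes> s)"
      using cd us(1,2) by (simp add: merge)
    finally have "x \<otimes> y = (\<one> \<ominus> (c \<oplus> c' \<ominus> c \<otimes> c' \<otimes> u) \<otimes> u) \<otimes> (\<one> \<ominus> (d \<oplus> d' \<ominus> d \<otimes> d' \<otimes> s) \<otimes> s)" .
    moreover have "c \<oplus> c' \<ominus> c \<otimes> c' \<otimes> u \<in> carrier A" "d \<oplus> d' \<ominus> d \<otimes> d' \<otimes> s \<in> carrier A"
      using cd us by auto
    ultimately show ?thesis
      by blast
  qed
  define S where "S = ?S"
  note S = S_sub[folded S_def] S_one[folded S_def] S_mult[folded S_def]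
    S_left[folded S_def] S_right[folded S_def]
  have "\<zero> \<in> S"
  proof (rule ccontr)
    assume "\<zero> \<notin> S"
    then have "{\<zero>} \<inter> S = {}"
      by blast
    then obtain P where P: "primeideal P A" "P \<inter> S = {}"
      using ex_prime_avoiding[OF S(1-3) zeroideal, of thesis] by blast
    interpret P: primeideal P A by fact
    have above: "\<exists>M\<in>MaxSpec A. P \<subseteq> M \<and> v \<in> M"
      if v: "v \<in> carrier A" "\<And>c. c \<in> carrier A \<Longrightarrow> \<one> \<ominus> c \<otimes> v \<in> S" for v
    proof (rule ccontr)
      assume no: "\<not> (\<exists>M\<in>MaxSpec A. P \<subseteq> M \<and> v \<in> M)"
      obtain p w where pw: "p \<in> P" "w \<in> PIdl v" "p \<oplus> w = \<one>"
      proof (rule coprime_decomposition[OF P.is_ideal cgenideal_ideal[OF v(1)]])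
        fix M assume "M \<in> MaxSpec A" "P \<subseteq> M" "PIdl v \<subseteq> M"
        then show False
          using no cgenideal_self[OF v(1)] by blast
      qed
      then obtain c where c: "c \<in> carrier A" "w = c \<otimes> v"
        by (auto simp: cgenideal_def)
      have "p = (p \<oplus> w) \<ominus> c \<otimes> v"
        using c v(1) P.Icarr[OF pw(1)] by algebra
      then have "p \<in> S"
        using v(2)[OF c(1)] pw(3) by simp
      with pw(1) P(2) show False
        by blast
    qed
    obtain M where M: "M \<in> MaxSpec A" "P \<subseteq> M" "u \<in> M"
      using above[OF us(1) S(4)] by blast
    obtain N where N: "N \<in> MaxSpec A" "P \<subseteq> N" "s \<in> N"
      using above[OF us(2) S(5)] by blast
    have "P \<in> Spec A"
      using P(1) by (simp add: Spec_def)
    then have "M = N"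
      using assms(2) M(1,2) N(1,2) unfolding gelfand_ring_def by blast
    then show False
      using M N us(3) one_in_maximal_contra by blast
  qed
  then show ?thesis
    using that unfolding S_def by auto
qed

section \<open>Kernels of localization maps\<close>

lemma loc_rel_iff:
  "((a, s), (b, t)) \<in> loc_rel A S \<longleftrightarrow>
     a \<in> carrier A \<and> b \<in> carrier A \<and> s \<in> S \<and> t \<in> S \<and>
     (\<exists>u \<in> S. u \<otimes>\<^bsub>A\<^esub> (a \<otimes>\<^bsub>A\<^esub> t \<ominus>\<^bsub>A\<^esub> b \<otimes>\<^bsub>A\<^esub> s) = \<zero>\<^bsub>A\<^esub>)"
  by (auto simp: loc_rel_def)

lemma (in cring) loc_frac_eq_zero_iff:
  assumes S: "S \<subseteq> carrier R" "\<one> \<in> S" "\<And>x y. x \<in> S \<Longrightarrow> y \<in> S \<Longrightarrow> x \<otimes> y \<in> S"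
    and a: "a \<in> carrier R"
  shows "loc_frac R S a \<one> = loc_frac R S \<zero> \<one> \<longleftrightarrow> (\<exists>u \<in> S. u \<otimes> a = \<zero>)"
proof
  assume eq: "loc_frac R S a \<one> = loc_frac R S \<zero> \<one>"
  have "(a, \<one>) \<in> loc_frac R S a \<one>"
    unfolding loc_frac_def using a S by (auto simp: loc_rel_iff a_minus_def r_neg intro!: bexI[of _ \<one>])
  then have "((\<zero>, \<one>), (a, \<one>)) \<in> loc_rel R S"
    unfolding eq by (simp add: loc_frac_def)
  then obtain u where u: "u \<in> S" "u \<otimes> (\<zero> \<otimes> \<one> \<ominus> a \<otimes> \<one>) = \<zero>"
    by (auto simp: loc_rel_iff)
  have "u \<otimes> a = \<ominus> (u \<otimes> (\<zero> \<otimes> \<one> \<ominus> a \<otimes> \<one>))"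
    using u(1) S(1) a by (auto simp: a_minus_def r_minus subset_iff)
  also have "\<dots> = \<zero>"
    using u by simp
  finally show "\<exists>u \<in> S. u \<otimes> a = \<zero>"
    using u(1) by blast
next
  assume "\<exists>u \<in> S. u \<otimes> a = \<zero>"
  then obtain u where u: "u \<in> S" "u \<otimes> a = \<zero>"
    by blast
  have uc: "u \<in> carrier R"
    using u S by blast
  have "((a, \<one>), (b, t)) \<in> loc_rel R S \<longleftrightarrow> ((\<zero>, \<one>), (b, t)) \<in> loc_rel R S" for b t
  proof (cases "b \<in> carrier R \<and> t \<in> S")
    case True
    then have bt: "b \<in> carrier R" "t \<in> carrier R"
      using S(1) by auto
    have swap: "(v \<otimes> u) \<otimes> (a \<otimes> t \<ominus> b \<otimes> \<one>) = (v \<otimes> u) \<otimes> (\<zero> \<otimes> t \<ominus> b \<otimes> \<one>)" if v: "v \<in> carrier R" for v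
    proof -
      have "(v \<otimes> u) \<otimes> (a \<otimes> t \<ominus> b \<otimes> \<one>) = (u \<otimes> a) \<otimes> (v \<otimes> t) \<oplus> (v \<otimes> u) \<otimes> (\<zero> \<otimes> t \<ominus> b \<otimes> \<one>)"
        using a uc bt v by algebra
      then show ?thesis
        using u a uc bt v by simp
    qed
    have transfer: "\<exists>w\<in>S. w \<otimes> y = \<zero>"
      if v: "v \<in> S" "v \<otimes> x = \<zero>" and x: "x \<in> carrier R"
        and swap: "(v \<otimes> u) \<otimes> y = (v \<otimes> u) \<otimes> x" for v x y
    proof -
      have "(v \<otimes> u) \<otimes> x = u \<otimes> (v \<otimes> x)"
        using v(1) x uc S(1) by (auto simp: m_ac subset_iff)
      then have "(v \<otimes> u) \<otimes> y = \<zero>"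
        using swap v(2) uc by simp
      then show ?thesis
        using S(3)[OF v(1) u(1)] by blast
    qed
    have "(\<exists>v\<in>S. v \<otimes> (a \<otimes> t \<ominus> b \<otimes> \<one>) = \<zero>) \<longleftrightarrow> (\<exists>v\<in>S. v \<otimes> (\<zero> \<otimes> t \<ominus> b \<otimes> \<one>) = \<zero>)"
    proof
      assume "\<exists>v\<in>S. v \<otimes> (a \<otimes> t \<ominus> b \<otimes> \<one>) = \<zero>"
      then obtain v where v: "v \<in> S" "v \<otimes> (a \<otimes> t \<ominus> b \<otimes> \<one>) = \<zero>"
        by blast
      show "\<exists>v\<in>S. v \<otimes> (\<zero> \<otimes> t \<ominus> b \<otimes> \<one>) = \<zero>"
        by (rule transfer[OF v _ swap[symmetric]]) (use v S(1) a bt in auto)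
    next
      assume "\<exists>v\<in>S. v \<otimes> (\<zero> \<otimes> t \<ominus> b \<otimes> \<one>) = \<zero>"
      then obtain v where v: "v \<in> S" "v \<otimes> (\<zero> \<otimes> t \<ominus> b \<otimes> \<one>) = \<zero>"
        by blast
      show "\<exists>v\<in>S. v \<otimes> (a \<otimes> t \<ominus> b \<otimes> \<one>) = \<zero>"
        by (rule transfer[OF v _ swap]) (use v S(1) a bt in auto)
    qed
    with True a S(2) show ?thesis
      by (simp add: loc_rel_iff)
  qed (auto simp: loc_rel_iff)
  then show "loc_frac R S a \<one> = loc_frac R S \<zero> \<one>"
    unfolding loc_frac_def by (simp add: set_eq_iff)
qed

text \<open>Maximal ideals are prime, and this makes the complement of $M$ a multiplicative set.\<close>

lemma (in cring) kernel_localization_at_maximal: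
  assumes "M \<in> MaxSpec R"
  shows "a_kernel R (localization_at R M) (loc_map R M) =
    {a \<in> carrier R. \<exists>u \<in> carrier R - M. u \<otimes> a = \<zero>}"
proof -
  interpret M: primeideal M R
    using assms maximalideal_prime by (auto simp: MaxSpec_def)
  have "loc_frac R (carrier R - M) a \<one> = loc_frac R (carrier R - M) \<zero> \<one> \<longleftrightarrow>
      (\<exists>u \<in> carrier R - M. u \<otimes> a = \<zero>)" if "a \<in> carrier R" for a
    by (rule loc_frac_eq_zero_iff) (use that MaxSpecD[OF assms] M.I_prime in auto)
  then show ?thesis
    by (auto simp: a_kernel_def' localization_at_def localization_def loc_map_def)
qed

section \<open>Ideals of elements vanishing near a closed set\<close>

text \<open>The elements that vanish in the localization at each closed point of $V(S)$, written without
  localizations: by \<open>kernel_localization_at_maximal\<close> this is the intersection of kernels in the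
  theorem.\<close>

definition vanishing_near :: "('a, 'm) ring_scheme \<Rightarrow> 'a set \<Rightarrow> 'a set" where
  "vanishing_near A S =
     {a \<in> carrier A. \<forall>M \<in> MaxSpec A. S \<subseteq> M \<longrightarrow> (\<exists>u \<in> carrier A - M. u \<otimes>\<^bsub>A\<^esub> a = \<zero>\<^bsub>A\<^esub>)}"

lemma (in cring) Inter_kernels_eq_vanishing_near:
  "carrier R \<inter> (\<Inter>M \<in> MaxSpec R \<inter> {P \<in> Spec R. S \<subseteq> P}.
      a_kernel R (localization_at R M) (loc_map R M)) = vanishing_near R S"
proof -
  have "MaxSpec R \<subseteq> Spec R"
    using maximalideal_prime by (auto simp: MaxSpec_def Spec_def)
  then show ?thesis
    by (auto simp: kernel_localization_at_maximal vanishing_near_def)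
qed

lemma (in cring) vanishing_near_ideal: "ideal (vanishing_near R S) R"
proof (rule idealI_elementwise)
  show "\<zero> \<in> vanishing_near R S"
    using MaxSpecD(2) by (auto simp: vanishing_near_def intro!: bexI[of _ \<one>])
  fix x y assume xy: "x \<in> vanishing_near R S" "y \<in> vanishing_near R S"
  have c: "x \<in> carrier R" "y \<in> carrier R"
    using xy by (auto simp: vanishing_near_def)
  have "\<exists>w\<in>carrier R - M. w \<otimes> (x \<oplus> y) = \<zero>" if M: "M \<in> MaxSpec R" "S \<subseteq> M" for M
  proof -
    interpret M: primeideal M R
      using M maximalideal_prime by (auto simp: MaxSpec_def)
    obtain u v where uv: "u \<in> carrier R - M" "u \<otimes> x = \<zero>" "v \<in> carrier R - M" "v \<otimes> y = \<zero>"
      using xy M unfolding vanishing_near_def by blast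
    have "(u \<otimes> v) \<otimes> (x \<oplus> y) = v \<otimes> (u \<otimes> x) \<oplus> u \<otimes> (v \<otimes> y)"
      using c uv(1,3) by (simp add: r_distr m_ac)
    also have "\<dots> = \<zero>"
      using uv by simp
    finally show ?thesis
      using uv M.I_prime by (intro bexI[of _ "u \<otimes> v"]) auto
  qed
  with c show "x \<oplus> y \<in> vanishing_near R S"
    by (simp add: vanishing_near_def)
next
  fix r x assume rx: "r \<in> carrier R" "x \<in> vanishing_near R S"
  have "u \<otimes> (r \<otimes> x) = \<zero>" if "u \<otimes> x = \<zero>" "u \<in> carrier R" for u
  proof -
    have "u \<otimes> (r \<otimes> x) = r \<otimes> (u \<otimes> x)"
      using rx that by (simp add: vanishing_near_def m_ac)
    then show ?thesis
      using rx that by simp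
  qed
  with rx show "r \<otimes> x \<in> vanishing_near R S"
    unfolding vanishing_near_def by fastforce
  then show "x \<otimes> r \<in> vanishing_near R S"
    using rx by (simp add: m_comm vanishing_near_def)
qed (auto simp: vanishing_near_def)

text \<open>If $e a = a$ with $e \in I$, then $1 - e$ kills $a$ and lies outside every maximal ideal above
  $I$. Conversely, an element killed by something outside each of these maximal ideals has an
  annihilator comaximal with $I$, and multiplying $1 = x + i$ by $a$ puts $a$ into $I$.\<close>

lemma (in cring) eq_vanishing_near_self:
  assumes I: "ideal I R" and unit: "\<And>a. a \<in> I \<Longrightarrow> \<exists>e\<in>I. e \<otimes> a = a"
  shows "I = vanishing_near R I"
proof
  interpret I: ideal I R by fact
  show "I \<subseteq> vanishing_near R I"
  proof
    fix a assume a: "a \<in> I"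
    then obtain e where e: "e \<in> I" "e \<otimes> a = a"
      using unit by blast
    note c = I.Icarr[OF a] I.Icarr[OF e(1)]
    have "\<one> \<ominus> e \<notin> M" if "M \<in> MaxSpec R" "I \<subseteq> M" for M
      using one_in_maximal_contra[OF that(1), of e "\<one> \<ominus> e"] e(1) that(2) c
      by (auto simp: a_minus_def r_neg2 a_comm[of \<one>])
    moreover have "(\<one> \<ominus> e) \<otimes> a = \<zero>"
    proof -
      have "(\<one> \<ominus> e) \<otimes> a = a \<ominus> e \<otimes> a"
        using c by algebra
      then show ?thesis
        using e c by (simp add: a_minus_def r_neg)
    qed
    moreover have "\<one> \<ominus> e \<in> carrier R"
      using c by simp
    ultimately show "a \<in> vanishing_near R I"
      using c unfolding vanishing_near_def by blast
  qed
  show "vanishing_near R I \<subseteq> I"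
  proof
    fix a assume a: "a \<in> vanishing_near R I"
    then have c: "a \<in> carrier R"
      by (simp add: vanishing_near_def)
    obtain x i where xi: "x \<in> {x \<in> carrier R. x \<otimes> a = \<zero>}" "i \<in> I" "x \<oplus> i = \<one>"
      by (rule coprime_decomposition[OF annihilator_ideal[OF c] I])
        (use a in \<open>auto simp: vanishing_near_def\<close>)
    have "a = (x \<oplus> i) \<otimes> a"
      using xi(3) c by simp
    also have "\<dots> = i \<otimes> a"
      using xi(1,2) c I.Icarr by (simp add: l_distr)
    finally show "a \<in> I"
      using I.I_r_closed[OF xi(2) c] by simp
  qed
qed

text \<open>The condition on $a$ makes its annihilator comaximal with the ideal generated by $S$, say
  $1 = u + s$. The fixing element is the factor $1 - c u$ of a zero product
  $(1 - c u)(1 - d s)$: it fixes $a$ since $u a = 0$, and the other factor shows that it vanishes near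
  $V(S)$, being congruent to $1$ modulo the ideal generated by $S$.\<close>

lemma vanishing_near_local_units:
  fixes A (structure)
  assumes "cring A" "gelfand_ring A" "S \<subseteq> carrier A" and a: "a \<in> vanishing_near A S"
  shows "\<exists>e \<in> vanishing_near A S. e \<otimes> a = a"
proof -
  interpret cring A by fact
  have c: "a \<in> carrier A"
    using a by (simp add: vanishing_near_def)
  have K: "ideal (Idl S) A"
    using assms(3) by (rule genideal_ideal)
  obtain u s where us: "u \<in> {x \<in> carrier A. x \<otimes> a = \<zero>}" "s \<in> Idl S" "u \<oplus> s = \<one>"
  proof (rule coprime_decomposition[OF annihilator_ideal[OF c] K])
    fix M assume M: "M \<in> MaxSpec A" "{x \<in> carrier A. x \<otimes> a = \<zero>} \<subseteq> M" "Idl S \<subseteq> M"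
    then have "S \<subseteq> M"
      using genideal_self[OF assms(3)] by simp
    then show False
      using a M(1,2) unfolding vanishing_near_def by blast
  qed
  have uc: "u \<in> carrier A" "s \<in> carrier A" "u \<otimes> a = \<zero>"
    using us ideal.Icarr[OF K] by auto
  obtain c' d where cd: "c' \<in> carrier A" "d \<in> carrier A"
    "(\<one> \<ominus> c' \<otimes> u) \<otimes> (\<one> \<ominus> d \<otimes> s) = \<zero>"
    using gelfand_orthogonal[OF assms(1,2) uc(1,2) us(3)] by blast
  have "\<one> \<ominus> d \<otimes> s \<notin> M" if M: "M \<in> MaxSpec A" "S \<subseteq> M" for M
  proof
    assume *: "\<one> \<ominus> d \<otimes> s \<in> M"
    have "Idl S \<subseteq> M"
      using MaxSpecD(1)[OF M(1)] M(2) by (rule genideal_minimal)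
    then have "d \<otimes> s \<in> M"
      using us(2) MaxSpecD(1)[OF M(1)] cd(2) by (auto intro: ideal.I_l_closed)
    moreover have "d \<otimes> s \<oplus> (\<one> \<ominus> d \<otimes> s) = \<one>"
      using cd uc by algebra
    ultimately show False
      using one_in_maximal_contra[OF M(1) _ *] by blast
  qed
  moreover have "(\<one> \<ominus> d \<otimes> s) \<otimes> (\<one> \<ominus> c' \<otimes> u) = \<zero>"
    using cd uc by (simp add: m_comm)
  ultimately have "\<one> \<ominus> c' \<otimes> u \<in> vanishing_near A S"
    using cd uc unfolding vanishing_near_def by blast
  moreover have "(\<one> \<ominus> c' \<otimes> u) \<otimes> a = a"
  proof -
    have "(\<one> \<ominus> c' \<otimes> u) \<otimes> a = a \<ominus> c' \<otimes> (u \<otimes> a)"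
      using cd uc(1) c by algebra
    then show ?thesis
      using cd uc(3) c by (simp add: a_minus_def)
  qed
  ultimately show ?thesis
    by blast
qed

section \<open>Pure ideals of Gelfand rings\<close>

theorem theorem7p2:
  fixes A :: "('a, 'm) ring_scheme"
  assumes "cring A" and "reduced_ring A" and "gelfand_ring A"
  shows "{I. pure_ideal TYPE('u) A I} =
         {carrier A \<inter> (\<Inter>M \<in> MaxSpec A \<inter> E. a_kernel A (localization_at A M) (loc_map A M)) | E.
            zariski_closed A E}"
proof -
  interpret cring A by fact
  have "{I. pure_ideal TYPE('u) A I} = {vanishing_near A S | S. S \<subseteq> carrier A}"
  proof (intro equalityI subsetI)
    fix I assume "I \<in> {I. pure_ideal TYPE('u) A I}"
    then have I: "ideal I A" "\<And>a. a \<in> I \<Longrightarrow> \<exists>e\<in>I. e \<otimes>\<^bsub>A\<^esub> a = a"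
      by (auto simp: pure_ideal_iff_local_units[OF assms(1)])
    then have "I = vanishing_near A I" "I \<subseteq> carrier A"
      using eq_vanishing_near_self ideal.Icarr by auto
    then show "I \<in> {vanishing_near A S | S. S \<subseteq> carrier A}"
      by blast
  next
    fix I assume "I \<in> {vanishing_near A S | S. S \<subseteq> carrier A}"
    then obtain S where "S \<subseteq> carrier A" "I = vanishing_near A S"
      by blast
    then show "I \<in> {I. pure_ideal TYPE('u) A I}"
      using vanishing_near_ideal vanishing_near_local_units[OF assms(1,3)]
      by (simp add: pure_ideal_iff_local_units[OF assms(1)])
  qed
  also have "\<dots> = {carrier A \<inter> (\<Inter>M \<in> MaxSpec A \<inter> E. a_kernel A (localization_at A M) (loc_map A M)) | E.
            zariski_closed A E}"
    unfolding zariski_closed_def Inter_kernels_eq_vanishing_near[symmetric] by blast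
  finally show ?thesis .
qed

end
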